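(* Let $1\le r<\infty$, $\gamma>0$, and let $L:\mathbb Z^+\to\mathcal L(\mathcal B^{r,\gamma},\mathcal X)$. Consider the nonhomogeneous system $x(n+1)=L(n)x_n+f(n)$, $n\ge 0$, and the associated homogeneous system $x(n+1)=L(n)x_n$, $n\ge 0$, and consider the condition (B) there exists $m\in\mathbb Z^-$ such that $\sup_{n\in\mathbb Z^+}\|L(n)P_{[-\infty,m]}\|_{\mathcal B^{r,\gamma}\to\mathcal X}<\infty$. Then: (1) If $1\le p\le q\le\infty$ and $(p,q)\ne(1,\infty)$, the following statements are equivalent: (i) the homogeneous system is uniformly exponentially stable in $\mathcal X$ with respect to $\mathcal B^{r,\gamma}$; (ii) the homogeneous system is uniformly exponentially stable in $\mathcal B^{r,\gamma}$; (iii) the nonhomogeneous system is $(\ell^p,\ell^q)$-stable and (B) holds. (2) The following statements are equivalent: (i) the homogeneous system is uniformly stable in $\mathcal B^{r,\gamma}$ (or, equivalently, uniformly stable in $\mathcal X$ with respect to $\mathcal B^{r,\gamma}$); (ii) the nonhomogeneous system is $(\ell^1,\ell^\infty)$-stable and (B) holds.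
   Context: $\mathbb Z^+$ and $\mathbb Z^-$ are the sets of nonnegative and nonpositive integers. $(\mathcal X,|\cdot|)$ is a (real or complex) Banach space. $\mathcal X^{\mathbb Z^-}$ is the vector space of all tuples $\varphi=(\varphi^{[m]})_{m\le 0}$ with $\varphi^{[m]}\in\mathcal X$; its zero vector is $0_{\mathcal B}$. For $1\le r<\infty$ and $\gamma\in\mathbb R$, $\mathcal B^{r,\gamma}=\{\varphi\in\mathcal X^{\mathbb Z^-}: |\varphi|_{\mathcal B^{r,\gamma}}:=(\sum_{m=-\infty}^0|e^{\gamma m}\varphi^{[m]}|^r)^{1/r}<\infty\}$. $\mathcal L(\mathcal B^{r,\gamma},\mathcal X)$ is the space of bounded linear operators with operator norm $\|\cdot\|_{\mathcal B^{r,\gamma}\to\mathcal X}$. For $1\le p\le\infty$, $\ell^p(\mathcal X)$ is the usual space of $p$-summable (bounded if $p=\infty$) functions $\mathbb Z^+\to\mathcal X$. For $x:\mathbb Z\to\mathcal X$ and $n\in\mathbb Z$, the prehistory $x_n\in\mathcal X^{\mathbb Z^-}$ is defined by $x_n^{[m]}=x(n+m)$, $m\le 0$. For $\tau\in\mathbb Z^+$, $\varphi\in\mathcal B^{r,\gamma}$ and $f:\mathbb Z^+\to\mathcal X$, $x(\cdot,\tau,\varphi;f):\mathbb Z\to\mathcal X$ is the unique function $x$ with $x_\tau=\varphi$ and $x(n+1)=L(n)x_n+f(n)$ for all $n\ge\tau$; $x_n(\tau,\varphi;f)$ is its prehistory at $n$. $\mathbf 0$ denotes the zero function $f$. $P_{[-\infty,m]}:\mathcal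 X^{\mathbb Z^-}\to\mathcal X^{\mathbb Z^-}$ keeps the coordinates with index $\le m$ and replaces all other coordinates by zero. The nonhomogeneous system is $(\ell^p,\ell^q)$-stable if $x(\cdot,0,0_{\mathcal B};f)$ (restricted to $\mathbb Z^+$) belongs to $\ell^q(\mathcal X)$ for every $f\in\ell^p(\mathcal X)$. With $\mathcal B=\mathcal B^{r,\gamma}$: the homogeneous system is uniformly exponentially stable in $\mathcal X$ with respect to $\mathcal B$ if there exist $K\ge1$, $\nu>0$ such that $|x(n,\tau,\varphi;\mathbf 0)|\le Ke^{-\nu(n-\tau)}|\varphi|_{\mathcal B}$ for all $n\ge\tau\ge0$ and $\varphi\in\mathcal B$; it is uniformly exponentially stable in $\mathcal B$ if the same holds with $|x(n,\tau,\varphi;\mathbf 0)|$ replaced by $|x_n(\tau,\varphi;\mathbf 0)|_{\mathcal B}$. Uniform stability in $\mathcal X$ with respect to $\mathcal B$, respectively in $\mathcal B$, is defined in the same way with $\nu=0$. *)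

theory Defs
  imports "HOL-Analysis.Analysis"
begin

text \<open>
  A tuple \<open>\<phi> = (\<phi>\<^sup>[\<^sup>m\<^sup>])\<close> indexed by the nonpositive integers \<open>m\<close> is encoded as a function
  \<open>\<phi> :: nat \<Rightarrow> 'a\<close>, where \<open>\<phi> j\<close> is the coordinate with index \<open>m = - int j\<close>.  Hence the weight
  \<open>exp (\<gamma> * m)\<close> of that coordinate is \<open>exp (\<gamma> * - real j)\<close>.

  The Banach space is a real one (class \<open>banach\<close>).  A complex Banach space is in particular a
  real one, complex-linear bounded operators are real-linear and bounded with the same operator
  norm, and scalars occur nowhere else, so the complex case is included.
\<close>

definition phase_space :: "real \<Rightarrow> real \<Rightarrow> (nat \<Rightarrow> 'a::real_normed_vector) set" where
  "phase_space r \<gamma> = {\<phi>. summable (\<lambda>j. norm (exp (\<gamma> * - real j) *\<^sub>R \<phi> j) powr r)}"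

definition phase_norm :: "real \<Rightarrow> real \<Rightarrow> (nat \<Rightarrow> 'a::real_normed_vector) \<Rightarrow> real" where
  "phase_norm r \<gamma> \<phi> = (\<Sum>j. norm (exp (\<gamma> * - real j) *\<^sub>R \<phi> j) powr r) powr (1 / r)"

text \<open>Membership in the space of bounded linear operators from the phase space to \<open>'a\<close>; the
  values of \<open>T\<close> outside the phase space are irrelevant.\<close>

definition bounded_linear_on_phase ::
  "real \<Rightarrow> real \<Rightarrow> ((nat \<Rightarrow> 'a::real_normed_vector) \<Rightarrow> 'a) \<Rightarrow> bool" where
  "bounded_linear_on_phase r \<gamma> T \<longleftrightarrow>
     (\<forall>\<phi>\<in>phase_space r \<gamma>. \<forall>\<psi>\<in>phase_space r \<gamma>. T (\<lambda>j. \<phi> j + \<psi> j) = T \<phi> + T \<psi>) \<and>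
     (\<forall>c. \<forall>\<phi>\<in>phase_space r \<gamma>. T (\<lambda>j. c *\<^sub>R \<phi> j) = c *\<^sub>R T \<phi>) \<and>
     (\<exists>C. \<forall>\<phi>\<in>phase_space r \<gamma>. norm (T \<phi>) \<le> C * phase_norm r \<gamma> \<phi>)"

text \<open>The analogue of \<^const>\<open>onorm\<close>; the zero vector contributes \<open>0 / 0 = 0\<close>.\<close>

definition phase_onorm ::
  "real \<Rightarrow> real \<Rightarrow> ((nat \<Rightarrow> 'a::real_normed_vector) \<Rightarrow> 'a) \<Rightarrow> real" where
  "phase_onorm r \<gamma> T = (SUP \<phi>\<in>phase_space r \<gamma>. norm (T \<phi>) / phase_norm r \<gamma> \<phi>)"

text \<open>\<open>P\<^bsub>[-\<infinity>,m]\<^esub>\<close>\<close>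

definition tail_proj :: "int \<Rightarrow> (nat \<Rightarrow> 'a::zero) \<Rightarrow> nat \<Rightarrow> 'a" where
  "tail_proj m \<phi> = (\<lambda>j. if - int j \<le> m then \<phi> j else 0)"

definition prehistory :: "(int \<Rightarrow> 'a) \<Rightarrow> int \<Rightarrow> nat \<Rightarrow> 'a" where
  "prehistory x n = (\<lambda>j. x (n - int j))"

definition is_solution ::
  "(nat \<Rightarrow> (nat \<Rightarrow> 'a::plus) \<Rightarrow> 'a) \<Rightarrow> nat \<Rightarrow> (nat \<Rightarrow> 'a) \<Rightarrow> (nat \<Rightarrow> 'a) \<Rightarrow> (int \<Rightarrow> 'a) \<Rightarrow> bool" where
  "is_solution L \<tau> \<phi> f x \<longleftrightarrow>
     prehistory x (int \<tau>) = \<phi> \<and>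
     (\<forall>n\<ge>\<tau>. x (int n + 1) = L n (prehistory x (int n)) + f n)"

definition solution ::
  "(nat \<Rightarrow> (nat \<Rightarrow> 'a::plus) \<Rightarrow> 'a) \<Rightarrow> nat \<Rightarrow> (nat \<Rightarrow> 'a) \<Rightarrow> (nat \<Rightarrow> 'a) \<Rightarrow> int \<Rightarrow> 'a" where
  "solution L \<tau> \<phi> f = (THE x. is_solution L \<tau> \<phi> f x)"

text \<open>The recursion determines \<open>x\<close> uniquely: \<open>h k\<close> below is the prehistory at time \<open>\<tau> + k\<close>.\<close>

lemma ex1_solution: "\<exists>!x. is_solution L \<tau> \<phi> f x"
proof (rule ex_ex1I)
  define h where "h = rec_nat \<phi> (\<lambda>k \<psi>. case_nat (L (\<tau> + k) \<psi> + f (\<tau> + k)) \<psi>)"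
  have h0: "h 0 = \<phi>"
    and hS: "h (Suc k) = case_nat (L (\<tau> + k) (h k) + f (\<tau> + k)) (h k)" for k
    by (simp_all add: h_def)
  have shift: "h (k + i) (i + j) = h k j" for k i j
    by (induction i) (simp_all add: hS)
  define x where "x = (\<lambda>i. h (nat (i - int \<tau>)) (nat (int \<tau> - i)))"
  have pre: "prehistory x (int \<tau> + int k) = h k" for k
  proof
    fix j
    show "prehistory x (int \<tau> + int k) j = h k j"
    proof (cases "j \<le> k")
      case True
      then have "x (int \<tau> + int k - int j) = h (k - j) 0"
        by (simp add: x_def nat_diff_distrib)
      also have "\<dots> = h k j"
        using shift[of "k - j" j 0] True by simp
      finally show ?thesis by (simp add: prehistory_def)
    next
      case False
      then have "x (int \<tau> + int k - int j) = h 0 (j - k)"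
        by (simp add: x_def nat_diff_distrib)
      also have "\<dots> = h k j"
        using shift[of 0 k "j - k"] False by simp
      finally show ?thesis by (simp add: prehistory_def)
    qed
  qed
  have "x (int n + 1) = L n (prehistory x (int n)) + f n" if n: "n \<ge> \<tau>" for n
  proof -
    obtain k where k: "n = \<tau> + k" using n le_Suc_ex by blast
    have "x (int n + 1) = prehistory x (int \<tau> + int (Suc k)) 0"
      by (simp add: prehistory_def k algebra_simps)
    also have "\<dots> = L n (h k) + f n"
      by (simp only: pre hS k nat.case)
    also have "h k = prehistory x (int n)"
      by (simp add: k flip: pre)
    finally show ?thesis .
  qed
  moreover have "prehistory x (int \<tau>) = \<phi>"
    using pre[of 0] by (simp add: h0)
  ultimately show "\<exists>x. is_solution L \<tau> \<phi> f x"
    unfolding is_solution_def by blast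
next
  fix x y
  assume x: "is_solution L \<tau> \<phi> f x" and y: "is_solution L \<tau> \<phi> f y"
  have pre: "prehistory x (int \<tau> + int k) = prehistory y (int \<tau> + int k)" for k
  proof (induction k)
    case 0
    then show ?case using x y by (simp add: is_solution_def)
  next
    case (Suc k)
    have step: "x (int (\<tau> + k) + 1) = y (int (\<tau> + k) + 1)"
    proof -
      have "x (int (\<tau> + k) + 1) = L (\<tau> + k) (prehistory x (int (\<tau> + k))) + f (\<tau> + k)"
        and "y (int (\<tau> + k) + 1) = L (\<tau> + k) (prehistory y (int (\<tau> + k))) + f (\<tau> + k)"
        using x y le_add1 unfolding is_solution_def by blast+
      then show ?thesis using Suc by (simp only: of_nat_add)
    qed
    show ?case
    proof
      fix j
      show "prehistory x (int \<tau> + int (Suc k)) j = prehistory y (int \<tau> + int (Suc k)) j"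
      proof (cases j)
        case 0
        then show ?thesis using step by (simp add: prehistory_def algebra_simps)
      next
        case (Suc i)
        then show ?thesis
          using fun_cong[OF \<open>prehistory x (int \<tau> + int k) = prehistory y (int \<tau> + int k)\<close>, of i]
          by (simp add: prehistory_def add_diff_eq)
      qed
    qed
  qed
  show "x = y"
  proof
    fix i
    show "x i = y i"
      using fun_cong[OF pre[of "nat (i - int \<tau>)"], of "nat (int \<tau> - i)"]
      by (cases "i \<le> int \<tau>") (simp_all add: prehistory_def)
  qed
qed

definition lp_space :: "ereal \<Rightarrow> (nat \<Rightarrow> 'a::real_normed_vector) set" where
  "lp_space p = (if p = \<infinity> then {f. bounded (range f)}
                 else {f. summable (\<lambda>n. norm (f n) powr real_of_ereal p)})"

definition lp_lq_stable ::
  "ereal \<Rightarrow> ereal \<Rightarrow> (nat \<Rightarrow> (nat \<Rightarrow> 'a::real_normed_vector) \<Rightarrow> 'a) \<Rightarrow> bool" where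
  "lp_lq_stable p q L \<longleftrightarrow>
     (\<forall>f\<in>lp_space p. (\<lambda>n. solution L 0 (\<lambda>_. 0) f (int n)) \<in> lp_space q)"

definition unif_exp_stable_X ::
  "real \<Rightarrow> real \<Rightarrow> (nat \<Rightarrow> (nat \<Rightarrow> 'a::real_normed_vector) \<Rightarrow> 'a) \<Rightarrow> bool" where
  "unif_exp_stable_X r \<gamma> L \<longleftrightarrow>
     (\<exists>K\<ge>1. \<exists>\<nu>>0. \<forall>\<tau> n. \<forall>\<phi>\<in>phase_space r \<gamma>. \<tau> \<le> n \<longrightarrow>
        norm (solution L \<tau> \<phi> (\<lambda>_. 0) (int n))
          \<le> K * exp (- \<nu> * (real n - real \<tau>)) * phase_norm r \<gamma> \<phi>)"

definition unif_exp_stable_B ::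
  "real \<Rightarrow> real \<Rightarrow> (nat \<Rightarrow> (nat \<Rightarrow> 'a::real_normed_vector) \<Rightarrow> 'a) \<Rightarrow> bool" where
  "unif_exp_stable_B r \<gamma> L \<longleftrightarrow>
     (\<exists>K\<ge>1. \<exists>\<nu>>0. \<forall>\<tau> n. \<forall>\<phi>\<in>phase_space r \<gamma>. \<tau> \<le> n \<longrightarrow>
        phase_norm r \<gamma> (prehistory (solution L \<tau> \<phi> (\<lambda>_. 0)) (int n))
          \<le> K * exp (- \<nu> * (real n - real \<tau>)) * phase_norm r \<gamma> \<phi>)"

definition unif_stable_X ::
  "real \<Rightarrow> real \<Rightarrow> (nat \<Rightarrow> (nat \<Rightarrow> 'a::real_normed_vector) \<Rightarrow> 'a) \<Rightarrow> bool" where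
  "unif_stable_X r \<gamma> L \<longleftrightarrow>
     (\<exists>K\<ge>1. \<forall>\<tau> n. \<forall>\<phi>\<in>phase_space r \<gamma>. \<tau> \<le> n \<longrightarrow>
        norm (solution L \<tau> \<phi> (\<lambda>_. 0) (int n)) \<le> K * phase_norm r \<gamma> \<phi>)"

definition unif_stable_B ::
  "real \<Rightarrow> real \<Rightarrow> (nat \<Rightarrow> (nat \<Rightarrow> 'a::real_normed_vector) \<Rightarrow> 'a) \<Rightarrow> bool" where
  "unif_stable_B r \<gamma> L \<longleftrightarrow>
     (\<exists>K\<ge>1. \<forall>\<tau> n. \<forall>\<phi>\<in>phase_space r \<gamma>. \<tau> \<le> n \<longrightarrow>
        phase_norm r \<gamma> (prehistory (solution L \<tau> \<phi> (\<lambda>_. 0)) (int n)) \<le> K * phase_norm r \<gamma> \<phi>)"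

text \<open>Condition (B).  The operators are bounded, so each operator norm is a genuine real number
  and finiteness of the supremum is boundedness above.\<close>

definition condition_B ::
  "real \<Rightarrow> real \<Rightarrow> (nat \<Rightarrow> (nat \<Rightarrow> 'a::real_normed_vector) \<Rightarrow> 'a) \<Rightarrow> bool" where
  "condition_B r \<gamma> L \<longleftrightarrow>
     (\<exists>m\<le>0. bdd_above (range (\<lambda>n. phase_onorm r \<gamma> (L n \<circ> tail_proj m))))"

end

theory Submission
  imports Defs
begin

text \<open>
  Write \<open>resp f\<close> for the solution with zero prehistory and forcing \<open>f\<close>.  Any sequence vanishing on the
  nonpositive integers is the response to its own residual, so a priori bounds on responses can be
  applied to sequences built from homogeneous solutions.  Stability and the Baire category theorem
  on the unit ball of \<open>\<ell>\<^sup>p\<close>, which is closed in the product topology, give a uniform bound on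
  responses.  Impulses together with (B) then bound the operators \<open>L n\<close> uniformly, so a homogeneous
  solution cut off at its initial time has an exponentially decaying residual: this is uniform
  stability.  If \<open>q < \<infinity>\<close>, the summability of solutions makes them small on some window of any
  prescribed length; if \<open>q = \<infinity>\<close> and \<open>p > 1\<close>, superposing cut-off solutions shows that they decay
  like \<open>N powr (1 / p - 1)\<close>.  Fading memory turns both into exponential stability.  Conversely,
  telescoping bounds responses by a convolution of the forcing with a decaying exponential.
\<close>

section \<open>Uniform boundedness on convex sets of sequences\<close>

text \<open>The product topology suits the Baire argument because a response at a fixed time depends
  on finitely many forcing values and is continuous there without any norm estimate. Its open sets
  contain no norm balls to rescale, so a neighbourhood of \<open>f0\<close> is reached by
  contracting the whole ball towards \<open>f0\<close>. (B) leaves finitely many coordinates of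
  \<open>L n\<close> uncontrolled. An impulse at time k makes the action of \<open>L n\<close> on
  coordinate j visible in a response when n = k + j + 1; for each j this misses only the finitely
  many n \<le> j. Cutting off a trajectory costs the forgotten initial history as forcing. Its
  weight shrinks by \<open>exp (- \<gamma>)\<close> per step, so \<gamma> > 0 makes this forcing
  summable, with l1 norm proportional to \<open>pn \<phi>\<close>, and hence admissible for every p
  at once. The pair (1, \<infinity>) is exceptional: boundedness of responses yields no summability,
  and the gain N powr (1 / p - 1) of the superposition is no gain at p = 1.\<close>

lemma tendsto_fun_iff:
  fixes h :: "'c \<Rightarrow> 'b \<Rightarrow> 'a::topological_space"
  shows "(h \<longlongrightarrow> l) F \<longleftrightarrow> (\<forall>i. ((\<lambda>m. h m i) \<longlongrightarrow> l i) F)"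
proof -
  have "(h \<longlongrightarrow> l) F \<longleftrightarrow> limitin (product_topology (\<lambda>_. euclidean) UNIV) h l F"
    by (simp add: euclidean_product_topology)
  then show ?thesis
    by (simp add: limitin_componentwise)
qed

text \<open>The hypothesis \<open>quasi\<close> replaces subadditivity, so that \<open>s\<close>-th powers of seminorms are allowed.\<close>

lemma uniform_boundedness_convex:
  fixes U :: "('b::countable \<Rightarrow> 'a::banach) set" and \<Psi> :: "'i \<Rightarrow> ('b \<Rightarrow> 'a) \<Rightarrow> real"
  assumes closed: "closed U"
    and convex: "\<And>f g t. \<lbrakk>f \<in> U; g \<in> U; 0 \<le> t; t \<le> 1\<rbrakk> \<Longrightarrow> (\<lambda>n. (1 - t) *\<^sub>R f n + t *\<^sub>R g n) \<in> U"
    and bdd: "\<And>f n. f \<in> U \<Longrightarrow> norm (f n) \<le> R n"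
    and cont: "\<And>i. continuous_on UNIV (\<Psi> i)"
    and quasi: "\<And>i f g t. \<lbrakk>f \<in> U; g \<in> U; 0 < t; t \<le> 1\<rbrakk> \<Longrightarrow>
        \<Psi> i g \<le> H t * (\<Psi> i f + \<Psi> i (\<lambda>n. (1 - t) *\<^sub>R f n + t *\<^sub>R g n))"
    and H: "\<And>t. 0 \<le> H t"
    and ptwise: "\<And>f. f \<in> U \<Longrightarrow> \<exists>B. \<forall>i. \<Psi> i f \<le> B"
  shows "\<exists>C. \<forall>f\<in>U. \<forall>i. \<Psi> i f \<le> C"
proof (cases "U = {}")
  case False
  define T where "T k = {f \<in> U. \<forall>i. \<Psi> i f \<le> real k}" for k :: nat
  have T_closed: "closed (T k)" for k
  proof -
    have "T k = U \<inter> (\<Inter>i. {f. \<Psi> i f \<le> real k})"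
      by (auto simp: T_def)
    moreover have "closed {f. \<Psi> i f \<le> real k}" for i
      by (intro closed_Collect_le cont continuous_on_const)
    ultimately show ?thesis
      using closed by (simp add: closed_INT closed_Int)
  qed
  have T_sub: "T k \<subseteq> U" for k
    by (auto simp: T_def)
  have U_eq: "\<Union> (range T) = U"
  proof -
    have "f \<in> \<Union> (range T)" if "f \<in> U" for f
    proof -
      from ptwise[OF that] obtain B where B: "\<forall>i. \<Psi> i f \<le> B" by blast
      obtain k :: nat where "B \<le> real k" using real_arch_simple by blast
      with B that have "f \<in> T k" unfolding T_def by (blast intro: order_trans)
      then show ?thesis by blast
    qed
    with T_sub show ?thesis by blast
  qed
  have "completely_metrizable_space (top_of_set U)"
    by (intro completely_metrizable_space_closedin completely_metrizable_space_euclidean)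
       (use closed in simp)
  \<comment> \<open>Baire in the subspace \<open>U\<close>: if no \<open>T k\<close> had interior
    relative to \<open>U\<close>, neither would their union, which is \<open>U\<close>
    itself.\<close>
  have "\<exists>k. top_of_set U interior_of T k \<noteq> {}"
  proof (rule ccontr)
    assume "\<not> ?thesis"
    then have "top_of_set U interior_of \<Union> (range T) = {}"
      using T_closed T_sub \<open>completely_metrizable_space (top_of_set U)\<close>
      by (intro Baire_category_alt) (auto simp: closed_subset)
    with False show False
      by (simp add: U_eq interior_of_openin)
  qed
  then obtain k where k: "top_of_set U interior_of T k \<noteq> {}" ..
  then obtain f0 V where V: "open V" "f0 \<in> V" "f0 \<in> U" "U \<inter> V \<subseteq> T k"
    by (auto simp: interior_of_def openin_open)
  \<comment> \<open>One \<open>t\<close> has to serve all \<open>g\<close>. Otherwise bad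
    \<open>g m\<close> for \<open>t = 1 / Suc m\<close> give points outside \<open>V\<close> that
    still converge to \<open>f0\<close> coordinatewise, because \<open>R n\<close> bounds the n-th
    coordinate over all of \<open>U\<close>.\<close>
  obtain t where t: "0 < t" "t \<le> 1"
    and tV: "\<And>g. g \<in> U \<Longrightarrow> (\<lambda>n. (1 - t) *\<^sub>R f0 n + t *\<^sub>R g n) \<in> V"
  proof (rule ccontr)
    assume "\<not> thesis"
    then have "\<exists>g\<in>U. (\<lambda>n. (1 - 1 / real (Suc m)) *\<^sub>R f0 n + (1 / real (Suc m)) *\<^sub>R g n) \<notin> V" for m
      using that[of "1 / real (Suc m)"] by (auto simp: field_simps)
    then obtain g where g: "\<And>m. g m \<in> U"
      "\<And>m. (\<lambda>n. (1 - 1 / real (Suc m)) *\<^sub>R f0 n + (1 / real (Suc m)) *\<^sub>R g m n) \<notin> V"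
      by metis
    define h where "h m n = (1 - 1 / real (Suc m)) *\<^sub>R f0 n + (1 / real (Suc m)) *\<^sub>R g m n" for m n
    have null: "(\<lambda>m. 1 / real (Suc m)) \<longlonglongrightarrow> 0"
      using LIMSEQ_inverse_real_of_nat by (simp add: inverse_eq_divide)
    have "h \<longlonglongrightarrow> f0"
      unfolding tendsto_fun_iff
    proof
      fix n
      have "(\<lambda>m. (1 / real (Suc m)) *\<^sub>R g m n) \<longlonglongrightarrow> 0"
      proof (rule Lim_null_comparison)
        show "\<forall>\<^sub>F m in sequentially. norm ((1 / real (Suc m)) *\<^sub>R g m n) \<le> 1 / real (Suc m) * R n"
          using bdd[OF g(1)] by (intro always_eventually allI) (auto simp: divide_right_mono)
        show "(\<lambda>m. 1 / real (Suc m) * R n) \<longlonglongrightarrow> 0"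
          using tendsto_mult_left_zero[OF null] .
      qed
      moreover have "(\<lambda>m. (1 - 1 / real (Suc m)) *\<^sub>R f0 n) \<longlonglongrightarrow> (1 - 0) *\<^sub>R f0 n"
        by (intro tendsto_intros null)
      ultimately have "(\<lambda>m. h m n) \<longlonglongrightarrow> (1 - 0) *\<^sub>R f0 n + 0"
        unfolding h_def by (rule tendsto_add[rotated])
      then show "(\<lambda>m. h m n) \<longlonglongrightarrow> f0 n" by simp
    qed
    then have "\<forall>\<^sub>F m in sequentially. h m \<in> V"
      using V topological_tendstoD by blast
    then obtain m where "h m \<in> V"
      by (auto simp: eventually_sequentially)
    with g(2)[of m] show False by (simp add: h_def[abs_def])
  qed
  obtain B where B: "\<And>i. \<Psi> i f0 \<le> B" using ptwise[OF V(3)] by blast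
  have "\<Psi> i g \<le> H t * (B + real k)" if "g \<in> U" for i g
  proof -
    have "(\<lambda>n. (1 - t) *\<^sub>R f0 n + t *\<^sub>R g n) \<in> T k"
      using V tV[OF that] convex[OF V(3) that] t by auto
    then have "\<Psi> i f0 + \<Psi> i (\<lambda>n. (1 - t) *\<^sub>R f0 n + t *\<^sub>R g n) \<le> B + real k"
      using B[of i] by (auto simp: T_def intro: add_mono)
    with quasi[OF V(3) that t, of i] H[of t] show ?thesis
      by (meson mult_left_mono order_trans)
  qed
  then show ?thesis by blast
qed auto

section \<open>Sequence spaces\<close>

text \<open>Bounds on partial sums are closed conditions in the product topology, in which the
  infinite sum is not continuous.\<close>

definition lp_ball :: "ereal \<Rightarrow> (nat \<Rightarrow> 'a::real_normed_vector) set" where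
  "lp_ball p = (if p = \<infinity> then {f. \<forall>n. norm (f n) \<le> 1}
                else {f. \<forall>N. (\<Sum>n<N. norm (f n) powr real_of_ereal p) \<le> 1})"

lemma real_of_ereal_ge_1: "1 \<le> p \<Longrightarrow> p \<noteq> \<infinity> \<Longrightarrow> 1 \<le> real_of_ereal p"
  by (cases p) auto

text \<open>Serves twice: for convexity of the balls, and for the recursion that bounds a
  convolution with an exponential in place of Young's inequality. In the degenerate cases the claim
  reduces to \<open>u powr s \<le> u\<close> on the unit interval.\<close>

lemma convex_powr:
  fixes a b t s :: real
  assumes "1 \<le> s" "0 \<le> a" "0 \<le> b" "0 \<le> t" "t \<le> 1"
  shows "((1 - t) * a + t * b) powr s \<le> (1 - t) * a powr s + t * b powr s"
proof (cases "a = 0 \<or> b = 0 \<or> t = 0 \<or> t = 1")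
  case True
  have le: "u powr s \<le> u" if "0 \<le> u" "u \<le> 1" for u :: real
    using powr_mono'[of 1 s u] assms(1) that by (cases "u = 0") auto
  have "t powr s * b powr s \<le> t * b powr s" "(1 - t) powr s * a powr s \<le> (1 - t) * a powr s"
    using assms le[of t] le[of "1 - t"] by (auto intro!: mult_right_mono)
  with True show ?thesis
    using assms by (auto simp: powr_mult)
next
  case False
  then show ?thesis
    using convex_onD[OF powr_convex[OF assms(1)], of t a b] assms by auto
qed

lemma powr_le_1D:
  fixes s x :: real
  assumes "x powr s \<le> 1" "0 \<le> x" "1 \<le> s"
  shows "x \<le> 1"
proof (rule ccontr)
  assume "\<not> x \<le> 1"
  then have "1 powr s < x powr s"
    using assms by (intro powr_less_mono2) auto
  with assms show False by simp
qed

lemma lp_ball_subset: "1 \<le> p \<Longrightarrow> lp_ball p \<subseteq> lp_space p"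
  by (auto simp: lp_ball_def lp_space_def bounded_iff intro: summableI_nonneg_bounded)

lemma lp_ball_norm_le:
  assumes "1 \<le> p" "f \<in> lp_ball p"
  shows "norm (f n) \<le> 1"
proof (cases "p = \<infinity>")
  case False
  define s where "s = real_of_ereal p"
  have s: "1 \<le> s" using real_of_ereal_ge_1[OF assms(1) False] by (simp add: s_def)
  have "norm (f n) powr s \<le> (\<Sum>k<Suc n. norm (f k) powr s)"
    by (simp add: sum_nonneg)
  also have "\<dots> \<le> 1" using assms False by (simp add: lp_ball_def s_def del: sum.lessThan_Suc)
  finally have "norm (f n) powr s \<le> 1" .
  then show ?thesis
    by (rule powr_le_1D[of _ s]) (use s in auto)
qed (use assms in \<open>simp add: lp_ball_def\<close>)

lemma lp_ball_closed: "closed (lp_ball p :: (nat \<Rightarrow> 'a::real_normed_vector) set)"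
  if "1 \<le> p"
proof (cases "p = \<infinity>")
  case True
  then have "lp_ball p = (\<Inter>n. {f :: nat \<Rightarrow> 'a. norm (f n) \<le> 1})"
    by (auto simp: lp_ball_def)
  moreover have "closed {f :: nat \<Rightarrow> 'a. norm (f n) \<le> 1}" for n
    by (intro closed_Collect_le continuous_intros) auto
  ultimately show ?thesis by auto
next
  case False
  define s where "s = real_of_ereal p"
  have s: "1 \<le> s" using real_of_ereal_ge_1[OF that False] by (simp add: s_def)
  have "lp_ball p = (\<Inter>N. {f :: nat \<Rightarrow> 'a. (\<Sum>n<N. norm (f n) powr s) \<le> 1})"
    using False by (auto simp: lp_ball_def s_def)
  moreover have "closed {f :: nat \<Rightarrow> 'a. (\<Sum>n<N. norm (f n) powr s) \<le> 1}" for N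
    using s by (intro closed_Collect_le continuous_on_sum continuous_on_powr' continuous_on_norm
        continuous_on_product_coordinates continuous_on_const) auto
  ultimately show ?thesis by auto
qed

lemma lp_ball_convex:
  assumes "1 \<le> p" "f \<in> lp_ball p" "g \<in> lp_ball p" "0 \<le> t" "t \<le> 1"
  shows "(\<lambda>n. (1 - t) *\<^sub>R f n + t *\<^sub>R g n) \<in> lp_ball p"
proof (cases "p = \<infinity>")
  case True
  have "norm ((1 - t) *\<^sub>R f n + t *\<^sub>R g n) \<le> (1 - t) * 1 + t * 1" for n
    using assms True
    by (intro norm_triangle_le add_mono) (auto simp: lp_ball_def intro!: mult_left_le)
  then show ?thesis using True by (simp add: lp_ball_def)
next
  case False
  define s where "s = real_of_ereal p"
  have s: "1 \<le> s" using real_of_ereal_ge_1[OF assms(1) False] by (simp add: s_def)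
  have "norm ((1 - t) *\<^sub>R f n + t *\<^sub>R g n) powr s
      \<le> (1 - t) * norm (f n) powr s + t * norm (g n) powr s" for n
  proof -
    have "norm ((1 - t) *\<^sub>R f n + t *\<^sub>R g n) \<le> (1 - t) * norm (f n) + t * norm (g n)"
      using assms by (intro norm_triangle_le) auto
    then show ?thesis
      using convex_powr[OF s, of "norm (f n)" "norm (g n)" t] assms s
      by (meson norm_ge_zero order_trans powr_mono2 zero_le_one)
  qed
  then have "(\<Sum>n<N. norm ((1 - t) *\<^sub>R f n + t *\<^sub>R g n) powr s)
      \<le> (1 - t) * (\<Sum>n<N. norm (f n) powr s) + t * (\<Sum>n<N. norm (g n) powr s)" for N
    by (simp add: sum_distrib_left sum_mono flip: sum.distrib)
  moreover have "(1 - t) * (\<Sum>n<N. norm (f n) powr s) + t * (\<Sum>n<N. norm (g n) powr s)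
      \<le> (1 - t) * 1 + t * 1" for N
    using assms False by (intro add_mono mult_left_mono) (auto simp: lp_ball_def s_def)
  ultimately have "(\<Sum>n<N. norm ((1 - t) *\<^sub>R f n + t *\<^sub>R g n) powr s) \<le> 1" for N
    by (smt (verit, ccfv_SIG) mult.right_neutral)
  then show ?thesis
    using False by (simp add: lp_ball_def s_def)
qed

text \<open>Interpolation between l1 and the sup norm: values of norm at most 1 satisfy
  \<open>norm (f n) powr s \<le> norm (f n)\<close>, so the lp norm is at most
  \<open>c powr (1 / s)\<close>. The exponent 0 is the convention 1 / \<infinity> = 0.\<close>

lemma lp_ballI_sum:
  fixes f :: "nat \<Rightarrow> 'a::real_normed_vector" and c :: real
  assumes "1 \<le> p" "\<And>n. norm (f n) \<le> 1" "\<And>N. (\<Sum>n<N. norm (f n)) \<le> c" "1 \<le> c"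
  shows "(\<lambda>n. (1 / c powr (if p = \<infinity> then 0 else 1 / real_of_ereal p)) *\<^sub>R f n) \<in> lp_ball p"
proof (cases "p = \<infinity>")
  case False
  define s where "s = real_of_ereal p"
  have s: "1 \<le> s" using real_of_ereal_ge_1[OF assms(1) False] by (simp add: s_def)
  have "norm ((1 / c powr (1 / s)) *\<^sub>R f n) powr s \<le> norm (f n) / c" for n
  proof -
    have "norm ((1 / c powr (1 / s)) *\<^sub>R f n) powr s = norm (f n) powr s / c"
      using assms(4) s by (simp add: powr_divide powr_powr)
    also have "norm (f n) powr s \<le> norm (f n)"
      using powr_mono'[of 1 s "norm (f n)"] assms(2)[of n] s by (cases "f n = 0") auto
    finally show ?thesis using assms(4) by (simp add: divide_right_mono)
  qed
  then have "(\<Sum>n<N. norm ((1 / c powr (1 / s)) *\<^sub>R f n) powr s) \<le> (\<Sum>n<N. norm (f n) / c)" for N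
    by (rule sum_mono)
  moreover have "(\<Sum>n<N. norm (f n) / c) \<le> 1" for N
    using assms(3)[of N] assms(4) by (simp add: field_simps flip: sum_divide_distrib)
  ultimately show ?thesis using False order_trans by (fastforce simp: lp_ball_def s_def simp del: norm_scaleR)
qed (use assms in \<open>simp add: lp_ball_def\<close>)

text \<open>For finite \<open>p\<close> the terms are eventually of norm at most 1, and from there
  on a larger exponent only decreases them.\<close>

lemma lp_space_mono:
  assumes "1 \<le> p" "p \<le> q" "f \<in> lp_space p"
  shows "f \<in> lp_space q"
proof (cases "p = \<infinity>")
  case True
  with assms show ?thesis by simp
next
  case False
  define s where "s = real_of_ereal p"
  have s: "1 \<le> s" using real_of_ereal_ge_1[OF assms(1) False] by (simp add: s_def)
  have sm: "summable (\<lambda>n. norm (f n) powr s)"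
    using assms False by (simp add: lp_space_def s_def)
  have "(\<lambda>n. norm (f n) powr s) \<longlonglongrightarrow> 0" by (rule summable_LIMSEQ_zero[OF sm])
  then have "\<forall>\<^sub>F n in sequentially. norm (f n) powr s < 1"
    by (rule order_tendstoD) simp
  then have ev: "\<forall>\<^sub>F n in sequentially. norm (f n) \<le> 1"
  proof eventually_elim
    case (elim n)
    show ?case by (rule powr_le_1D[of _ s]) (use s elim in auto)
  qed
  show ?thesis
  proof (cases "q = \<infinity>")
    case True
    from ev obtain N where "\<forall>n\<ge>N. norm (f n) \<le> 1" by (auto simp: eventually_sequentially)
    then have "Bseq (\<lambda>n. f (n + N))" by (intro BseqI[of 1]) auto
    then have "Bseq f" by (rule Bseq_offset)
    with True show ?thesis by (simp add: lp_space_def Bseq_eq_bounded)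
  next
    case False
    with assms \<open>p \<noteq> \<infinity>\<close> have le: "s \<le> real_of_ereal q"
      by (cases p; cases q) (auto simp: s_def)
    from ev have "\<forall>\<^sub>F n in sequentially. norm (norm (f n) powr real_of_ereal q) \<le> norm (f n) powr s"
    proof eventually_elim
      case (elim n)
      then show ?case using le powr_mono'[of s _ "norm (f n)"] by (cases "f n = 0") simp_all
    qed
    then have "summable (\<lambda>n. norm (f n) powr real_of_ereal q)"
      using sm by (rule summable_comparison_test_ev)
    with False show ?thesis by (simp add: lp_space_def)
  qed
qed

section \<open>Phase spaces and solutions\<close>

text \<open>Superadditivity takes the place of Minkowski's inequality: in
  \<open>phase_norm_case_nat\<close> the r-th powers of the new value and of the shifted history add
  exactly, and this lemma turns that into a sum of norms.\<close>

lemma powr_add_le: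
  fixes x y r :: real
  assumes "1 \<le> r" "0 \<le> x" "0 \<le> y"
  shows "x powr r + y powr r \<le> (x + y) powr r"
proof -
  have split: "u powr r = u * u powr (r - 1)" if "0 \<le> u" for u :: real
    using powr_add[of u 1 "r - 1"] that by simp
  have "x * x powr (r - 1) + y * y powr (r - 1) \<le> x * (x + y) powr (r - 1) + y * (x + y) powr (r - 1)"
    using assms by (intro add_mono mult_left_mono powr_mono2) auto
  also have "\<dots> = (x + y) powr r"
    using split[of "x + y"] assms by (simp only: distrib_right add_nonneg_nonneg)
  finally show ?thesis
    by (simp only: split[OF assms(2)] split[OF assms(3)])
qed

lemma add_powr_le:
  fixes x y s :: real
  assumes "0 \<le> s" "0 \<le> x" "0 \<le> y"
  shows "(x + y) powr s \<le> 2 powr s * (x powr s + y powr s)"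
proof -
  have "(x + y) powr s \<le> (2 * max x y) powr s"
    using assms by (intro powr_mono2) auto
  also have "\<dots> = 2 powr s * max x y powr s"
    using assms by (simp add: powr_mult)
  also have "\<dots> \<le> 2 powr s * (x powr s + y powr s)"
    by (cases "x \<le> y") (simp_all add: max_def)
  finally show ?thesis .
qed

lemma phase_norm_nonneg [simp]: "0 \<le> phase_norm r \<gamma> \<phi>"
  by (simp add: phase_norm_def)

lemma phase_norm_powr:
  assumes "1 \<le> r" "\<phi> \<in> phase_space r \<gamma>"
  shows "phase_norm r \<gamma> \<phi> powr r = (\<Sum>j. norm (exp (\<gamma> * - real j) *\<^sub>R \<phi> j) powr r)"
proof -
  have "0 \<le> (\<Sum>j. norm (exp (\<gamma> * - real j) *\<^sub>R \<phi> j) powr r)"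
    using assms(2) unfolding phase_space_def mem_Collect_eq by (rule suminf_nonneg) (rule powr_ge_zero)
  with assms(1) show ?thesis
    unfolding phase_norm_def powr_powr by (simp del: norm_scaleR)
qed

lemma phase_norm_leI:
  assumes "1 \<le> r" "(\<Sum>j. norm (exp (\<gamma> * - real j) *\<^sub>R \<phi> j) powr r) \<le> c powr r" "0 \<le> c"
    and "\<phi> \<in> phase_space r \<gamma>"
  shows "phase_norm r \<gamma> \<phi> \<le> c"
proof (rule ccontr)
  assume "\<not> ?thesis"
  then have "c powr r < phase_norm r \<gamma> \<phi> powr r"
    using assms by (intro powr_less_mono2) auto
  then show False
    using assms(2) unfolding phase_norm_powr[OF assms(1,4)] by linarith
qed

lemma
  assumes "1 \<le> r" "\<psi> \<in> phase_space r \<gamma>" "\<And>j. norm (\<phi> j) \<le> norm (\<psi> j)"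
  shows phase_space_mono: "\<phi> \<in> phase_space r \<gamma>"
    and phase_norm_mono: "phase_norm r \<gamma> \<phi> \<le> phase_norm r \<gamma> \<psi>"
proof -
  have le: "norm (exp (\<gamma> * - real j) *\<^sub>R \<phi> j) powr r \<le> norm (exp (\<gamma> * - real j) *\<^sub>R \<psi> j) powr r" for j
    by (rule powr_mono2) (use assms in \<open>auto intro: mult_left_mono\<close>)
  have sm: "summable (\<lambda>j. norm (exp (\<gamma> * - real j) *\<^sub>R \<psi> j) powr r)"
    using assms(2) by (simp only: phase_space_def mem_Collect_eq)
  have sm': "summable (\<lambda>j. norm (exp (\<gamma> * - real j) *\<^sub>R \<phi> j) powr r)"
  proof (rule summable_comparison_test'[OF sm])
    show "norm (norm (exp (\<gamma> * - real j) *\<^sub>R \<phi> j) powr r)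
        \<le> norm (exp (\<gamma> * - real j) *\<^sub>R \<psi> j) powr r" for j
      using le[of j] by (simp only: real_norm_def abs_of_nonneg[OF powr_ge_zero])
  qed
  then show \<phi>: "\<phi> \<in> phase_space r \<gamma>"
    by (simp only: phase_space_def mem_Collect_eq)
  show "phase_norm r \<gamma> \<phi> \<le> phase_norm r \<gamma> \<psi>"
    using suminf_le[OF le sm' sm]
    by (intro phase_norm_leI[OF assms(1)] \<phi>) (simp_all only: phase_norm_powr[OF assms(1,2)] phase_norm_nonneg)
qed

lemma phase_space_add:
  assumes "1 \<le> r" "\<phi> \<in> phase_space r \<gamma>" "\<psi> \<in> phase_space r \<gamma>"
  shows "(\<lambda>j. \<phi> j + \<psi> j) \<in> phase_space r \<gamma>"
proof -
  define w where "w \<phi> j = norm (exp (\<gamma> * - real j) *\<^sub>R \<phi> j)" for \<phi> :: "nat \<Rightarrow> 'a" and j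
  have w: "\<phi> \<in> phase_space r \<gamma> \<longleftrightarrow> summable (\<lambda>j. w \<phi> j powr r)" for \<phi>
    by (simp only: phase_space_def w_def mem_Collect_eq)
  have w_nonneg: "0 \<le> w \<phi> j" for \<phi> j by (simp only: w_def norm_ge_zero)
  have le: "w (\<lambda>j. \<phi> j + \<psi> j) j powr r \<le> 2 powr r * (w \<phi> j powr r + w \<psi> j powr r)" for j
  proof -
    have "w (\<lambda>j. \<phi> j + \<psi> j) j \<le> w \<phi> j + w \<psi> j"
      by (simp only: w_def scaleR_add_right norm_triangle_ineq)
    then have "w (\<lambda>j. \<phi> j + \<psi> j) j powr r \<le> (w \<phi> j + w \<psi> j) powr r"
      using assms(1) w_nonneg by (intro powr_mono2) auto
    also have "\<dots> \<le> 2 powr r * (w \<phi> j powr r + w \<psi> j powr r)"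
      using assms(1) w_nonneg by (intro add_powr_le) auto
    finally show ?thesis .
  qed
  have "summable (\<lambda>j. 2 powr r * (w \<phi> j powr r + w \<psi> j powr r))"
    using assms(2,3) unfolding w by (intro summable_mult summable_add)
  then have "summable (\<lambda>j. w (\<lambda>j. \<phi> j + \<psi> j) j powr r)"
    by (rule summable_comparison_test'[where N = 0]) (use le in simp)
  then show ?thesis by (simp only: w)
qed

lemma phase_space_scaleR:
  assumes "\<phi> \<in> phase_space r \<gamma>"
  shows "(\<lambda>j. c *\<^sub>R \<phi> j) \<in> phase_space r \<gamma>"
proof -
  have "norm (exp (\<gamma> * - real j) *\<^sub>R c *\<^sub>R \<phi> j) powr r
      = \<bar>c\<bar> powr r * norm (exp (\<gamma> * - real j) *\<^sub>R \<phi> j) powr r" for j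
  proof -
    have "norm (exp (\<gamma> * - real j) *\<^sub>R c *\<^sub>R \<phi> j) = \<bar>c\<bar> * norm (exp (\<gamma> * - real j) *\<^sub>R \<phi> j)"
      by (simp add: abs_mult)
    then show ?thesis by (simp only: powr_mult abs_ge_zero norm_ge_zero)
  qed
  then show ?thesis
    using assms unfolding phase_space_def mem_Collect_eq by (simp only: summable_mult)
qed

lemma phase_space_finite:
  assumes "\<And>j. j \<ge> N \<Longrightarrow> \<phi> j = 0"
  shows "\<phi> \<in> phase_space r \<gamma>"
  unfolding phase_space_def mem_Collect_eq
  by (rule summable_finite[of "{..<N}"]) (use assms in \<open>auto simp: not_less\<close>)

lemma norm_coord_le_phase_norm:
  assumes "1 \<le> r" "\<phi> \<in> phase_space r \<gamma>"
  shows "norm (\<phi> j) \<le> exp (\<gamma> * real j) * phase_norm r \<gamma> \<phi>"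
proof -
  let ?w = "\<lambda>j. norm (exp (\<gamma> * - real j) *\<^sub>R \<phi> j)"
  have "?w j \<le> phase_norm r \<gamma> \<phi>"
  proof (rule ccontr)
    assume "\<not> ?thesis"
    then have "phase_norm r \<gamma> \<phi> powr r < ?w j powr r"
      using assms by (intro powr_less_mono2) auto
    moreover have "(\<Sum>j\<in>{j}. ?w j powr r) \<le> (\<Sum>j. ?w j powr r)"
      using assms(2) unfolding phase_space_def mem_Collect_eq
      by (rule sum_le_suminf) (simp_all only: powr_ge_zero finite.intros)
    then have "?w j powr r \<le> phase_norm r \<gamma> \<phi> powr r"
      unfolding phase_norm_powr[OF assms] by (simp del: norm_scaleR)
    ultimately show False by linarith
  qed
  then have "exp (\<gamma> * real j) * ?w j \<le> exp (\<gamma> * real j) * phase_norm r \<gamma> \<phi>"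
    by (intro mult_left_mono) auto
  moreover have "exp (\<gamma> * real j) * ?w j = norm (\<phi> j)"
    by (simp add: mult.assoc[symmetric] flip: exp_add)
  ultimately show ?thesis by (simp only:)
qed

text \<open>\<open>case_nat a \<phi>\<close> is the prehistory one time step later. The factor
  \<open>exp (- \<gamma>)\<close> on the old prehistory is the fading memory behind the decay
  estimates.\<close>

lemma
  assumes "1 \<le> r" "\<phi> \<in> phase_space r \<gamma>"
  shows phase_space_case_nat: "case_nat a \<phi> \<in> phase_space r \<gamma>"
    and phase_norm_case_nat: "phase_norm r \<gamma> (case_nat a \<phi>) \<le> norm a + exp (- \<gamma>) * phase_norm r \<gamma> \<phi>"
proof -
  let ?w = "\<lambda>\<phi> j. norm (exp (\<gamma> * - real j) *\<^sub>R \<phi> j) powr r"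
  have Suc: "?w (case_nat a \<phi>) (Suc j) = exp (- \<gamma>) powr r * ?w \<phi> j" for j
  proof -
    have "exp (\<gamma> * - real (Suc j)) = exp (- \<gamma>) * exp (\<gamma> * - real j)"
      by (simp add: algebra_simps flip: exp_add)
    then have "norm (exp (\<gamma> * - real (Suc j)) *\<^sub>R \<phi> j) = exp (- \<gamma>) * norm (exp (\<gamma> * - real j) *\<^sub>R \<phi> j)"
      by simp
    then show ?thesis by (simp only: powr_mult exp_ge_zero norm_ge_zero nat.case)
  qed
  have sm: "summable (?w \<phi>)"
    using assms(2) by (simp only: phase_space_def mem_Collect_eq)
  then have sm': "summable (?w (case_nat a \<phi>))"
    by (subst summable_Suc_iff[symmetric]) (simp only: Suc summable_mult)
  then show B: "case_nat a \<phi> \<in> phase_space r \<gamma>"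
    by (simp only: phase_space_def mem_Collect_eq)
  have "(\<Sum>j. ?w (case_nat a \<phi>) j) = norm a powr r + (\<Sum>j. ?w (case_nat a \<phi>) (Suc j))"
    using suminf_split_head[OF sm'] by (simp del: norm_scaleR)
  also have "(\<Sum>j. ?w (case_nat a \<phi>) (Suc j)) = exp (- \<gamma>) powr r * phase_norm r \<gamma> \<phi> powr r"
    by (simp only: Suc suminf_mult[OF sm] phase_norm_powr[OF assms])
  also have "\<dots> = (exp (- \<gamma>) * phase_norm r \<gamma> \<phi>) powr r"
    by (simp add: powr_mult)
  also have "norm a powr r + \<dots> \<le> (norm a + exp (- \<gamma>) * phase_norm r \<gamma> \<phi>) powr r"
    by (intro powr_add_le assms) auto
  finally show "phase_norm r \<gamma> (case_nat a \<phi>) \<le> norm a + exp (- \<gamma>) * phase_norm r \<gamma> \<phi>"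
    by (intro phase_norm_leI assms B) auto
qed

lemma
  assumes "1 \<le> r" "\<phi> \<in> phase_space r \<gamma>"
  shows phase_space_shift: "(\<lambda>j. if j < k then 0 else \<phi> (j - k)) \<in> phase_space r \<gamma>"
    and phase_norm_shift:
      "phase_norm r \<gamma> (\<lambda>j. if j < k then 0 else \<phi> (j - k)) \<le> exp (- \<gamma> * real k) * phase_norm r \<gamma> \<phi>"
proof (induction k)
  case 0
  { case 1 show ?case using assms by simp }
  { case 2 show ?case by simp }
next
  case (Suc k)
  let ?s = "\<lambda>k j. if j < k then 0 else \<phi> (j - k)"
  have eq: "?s (Suc k) = case_nat 0 (?s k)"
    by (auto simp: fun_eq_iff split: nat.split)
  { case 1 show ?case unfolding eq by (rule phase_space_case_nat[OF assms(1) Suc(1)]) }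
  { case 2
    have "phase_norm r \<gamma> (?s (Suc k)) \<le> exp (- \<gamma>) * phase_norm r \<gamma> (?s k)"
      unfolding eq using phase_norm_case_nat[OF assms(1) Suc(1), of 0] by simp
    also have "\<dots> \<le> exp (- \<gamma>) * (exp (- \<gamma> * real k) * phase_norm r \<gamma> \<phi>)"
      by (intro mult_left_mono Suc(2)) auto
    also have "\<dots> = exp (- \<gamma> * real (Suc k)) * phase_norm r \<gamma> \<phi>"
      by (simp add: algebra_simps flip: exp_add)
    finally show ?case . }
qed

text \<open>Plays two roles: as a history it is the vector \<open>v\<close> at lag \<open>j\<close>,
  as a forcing it is an impulse at time \<open>j\<close>.\<close>

definition single :: "nat \<Rightarrow> 'a::zero \<Rightarrow> nat \<Rightarrow> 'a" where
  "single j v = (\<lambda>i. if i = j then v else 0)"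

lemma single_in_phase_space [simp]: "single j v \<in> phase_space r \<gamma>"
  by (rule phase_space_finite[of "Suc j"]) (auto simp: single_def)

lemma phase_norm_single_le:
  assumes "1 \<le> r" "0 < \<gamma>"
  shows "phase_norm r \<gamma> (single j v) \<le> norm v"
proof -
  have z: "(\<lambda>_. 0) \<in> phase_space r \<gamma>" by (rule phase_space_finite[of 0]) auto
  have eq: "single j v = (\<lambda>i. if i < j then 0 else case_nat v (\<lambda>_. 0) (i - j))"
    by (auto simp: single_def fun_eq_iff split: nat.split)
  have "phase_norm r \<gamma> (case_nat v (\<lambda>_. 0)) \<le> norm v"
    using phase_norm_case_nat[OF assms(1) z, of v] assms by (simp add: phase_norm_def)
  moreover have "exp (- \<gamma> * real j) \<le> 1" using assms by simp
  ultimately have "exp (- \<gamma> * real j) * phase_norm r \<gamma> (case_nat v (\<lambda>_. 0)) \<le> 1 * norm v"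
    by (intro mult_mono) auto
  then show ?thesis
    unfolding eq using phase_norm_shift[OF assms(1) phase_space_case_nat[OF assms(1) z], of j v]
    by linarith
qed

section \<open>Solutions, restarts and residuals\<close>

lemma prehistory_Suc: "prehistory x (n + 1) = case_nat (x (n + 1)) (prehistory x n)"
  by (auto simp: prehistory_def fun_eq_iff algebra_simps split: nat.split)

lemma is_solution_solution: "is_solution L \<tau> \<phi> f (solution L \<tau> \<phi> f)"
  unfolding solution_def using ex1_solution[of L \<tau> \<phi> f] by (rule theI')

lemma solution_eqI: "is_solution L \<tau> \<phi> f x \<Longrightarrow> solution L \<tau> \<phi> f = x"
  unfolding solution_def by (rule the1_equality[OF ex1_solution])

lemma prehistory_solution_init [simp]: "prehistory (solution L \<tau> \<phi> f) (int \<tau>) = \<phi>"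
  using is_solution_solution[of L \<tau> \<phi> f] by (simp add: is_solution_def)

lemma solution_step:
  "\<tau> \<le> n \<Longrightarrow> solution L \<tau> \<phi> f (int n + 1) = L n (prehistory (solution L \<tau> \<phi> f) (int n)) + f n"
  using is_solution_solution[of L \<tau> \<phi> f] by (simp add: is_solution_def)

lemma solution_past: "solution L \<tau> \<phi> f (int \<tau> - int j) = \<phi> j"
  using fun_cong[OF prehistory_solution_init[of L \<tau> \<phi> f], of j] by (simp add: prehistory_def)

lemma solution_restart:
  fixes L :: "nat \<Rightarrow> (nat \<Rightarrow> 'a::monoid_add) \<Rightarrow> 'a"
  assumes "\<tau> \<le> k"
  shows "solution L k (prehistory (solution L \<tau> \<phi> f) (int k)) f = solution L \<tau> \<phi> f"
  using assms by (intro solution_eqI) (auto simp: is_solution_def solution_step)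

definition residual :: "(nat \<Rightarrow> (nat \<Rightarrow> 'a::minus) \<Rightarrow> 'a) \<Rightarrow> (int \<Rightarrow> 'a) \<Rightarrow> nat \<Rightarrow> 'a" where
  "residual L x n = x (int n + 1) - L n (prehistory x (int n))"

lemma solution_residual:
  fixes L :: "nat \<Rightarrow> (nat \<Rightarrow> 'a::ab_group_add) \<Rightarrow> 'a"
  assumes "\<And>i. i \<le> 0 \<Longrightarrow> x i = 0"
  shows "solution L 0 (\<lambda>_. 0) (residual L x) = x"
  using assms by (intro solution_eqI) (auto simp: is_solution_def residual_def prehistory_def fun_eq_iff)

lemma sum_exp_neg_le:
  assumes "(0::real) < \<gamma>"
  shows "(\<Sum>k<N. exp (- \<gamma> * real k)) \<le> 1 / (1 - exp (- \<gamma>))"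
proof -
  have eq: "exp (- \<gamma> * real k) = exp (- \<gamma>) ^ k" for k
    using exp_of_nat_mult[of k "- \<gamma>"] by (simp add: mult.commute)
  have "(\<Sum>k<N. exp (- \<gamma>) ^ k) \<le> (\<Sum>k. exp (- \<gamma>) ^ k)"
    using assms by (intro sum_le_suminf summable_geometric) auto
  then show ?thesis
    using assms by (simp only: eq) (simp add: suminf_geometric)
qed

lemma sum_exp_neg_shift_le:
  assumes "(0::real) < \<gamma>"
  shows "(\<Sum>n<N. if n < k then 0 else exp (- \<gamma> * real (n - k))) \<le> 1 / (1 - exp (- \<gamma>))"
proof -
  have "(\<Sum>n<N. if n < k then 0 else exp (- \<gamma> * real (n - k)))
      = (\<Sum>n\<in>{k..<N}. exp (- \<gamma> * real (n - k)))"
    by (rule sum.mono_neutral_cong_right) auto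
  also have "\<dots> = (\<Sum>i<N - k. exp (- \<gamma> * real i))"
    by (rule sum.reindex_bij_witness[of _ "\<lambda>i. i + k" "\<lambda>n. n - k"]) auto
  also have "\<dots> \<le> 1 / (1 - exp (- \<gamma>))" by (rule sum_exp_neg_le[OF assms])
  finally show ?thesis .
qed

lemma all_le_iff: "(\<forall>\<tau> n. \<forall>\<phi>\<in>A. \<tau> \<le> n \<longrightarrow> P \<tau> n \<phi>) \<longleftrightarrow> (\<forall>\<tau> k. \<forall>\<phi>\<in>A. P \<tau> (\<tau> + k) \<phi>)"
  for P :: "nat \<Rightarrow> nat \<Rightarrow> 'b \<Rightarrow> bool"
  by (metis le_add1 le_Suc_ex)

section \<open>Uniform bounds from input-output stability\<close>

locale delay_system =
  fixes r \<gamma> :: real and L :: "nat \<Rightarrow> (nat \<Rightarrow> 'a::banach) \<Rightarrow> 'a"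
  assumes r: "1 \<le> r" and \<gamma>: "0 < \<gamma>"
    and lin: "\<And>n. bounded_linear_on_phase r \<gamma> (L n)"
begin

abbreviation B :: "(nat \<Rightarrow> 'a) set" where "B \<equiv> phase_space r \<gamma>"
abbreviation pn :: "(nat \<Rightarrow> 'a) \<Rightarrow> real" where "pn \<equiv> phase_norm r \<gamma>"
abbreviation resp :: "(nat \<Rightarrow> 'a) \<Rightarrow> int \<Rightarrow> 'a" where "resp f \<equiv> solution L 0 (\<lambda>_. 0) f"
abbreviation hom :: "nat \<Rightarrow> (nat \<Rightarrow> 'a) \<Rightarrow> int \<Rightarrow> 'a" where "hom \<tau> \<phi> \<equiv> solution L \<tau> \<phi> (\<lambda>_. 0)"

lemma zero_in_B [simp]: "(\<lambda>_. 0) \<in> B"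
  by (rule phase_space_finite[of 0]) auto

lemma L_comb:
  assumes "\<phi> \<in> B" "\<psi> \<in> B"
  shows "L n (\<lambda>j. a *\<^sub>R \<phi> j + b *\<^sub>R \<psi> j) = a *\<^sub>R L n \<phi> + b *\<^sub>R L n \<psi>"
proof -
  have "L n (\<lambda>j. a *\<^sub>R \<phi> j + b *\<^sub>R \<psi> j) = L n (\<lambda>j. a *\<^sub>R \<phi> j) + L n (\<lambda>j. b *\<^sub>R \<psi> j)"
    using lin[of n] phase_space_scaleR[OF assms(1), of a] phase_space_scaleR[OF assms(2), of b]
    unfolding bounded_linear_on_phase_def by simp
  also have "\<dots> = a *\<^sub>R L n \<phi> + b *\<^sub>R L n \<psi>"
    using lin[of n] assms unfolding bounded_linear_on_phase_def by simp
  finally show ?thesis .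
qed

lemma L_zero [simp]: "L n (\<lambda>_. 0) = 0"
  using L_comb[OF zero_in_B zero_in_B, of n 0 0] by simp

lemma L_bound: "\<exists>C\<ge>0. \<forall>\<phi>\<in>B. norm (L n \<phi>) \<le> C * pn \<phi>"
proof -
  obtain C where C: "\<forall>\<phi>\<in>B. norm (L n \<phi>) \<le> C * pn \<phi>"
    using lin[of n] unfolding bounded_linear_on_phase_def by blast
  have "norm (L n \<phi>) \<le> \<bar>C\<bar> * pn \<phi>" if "\<phi> \<in> B" for \<phi>
    using C[rule_format, OF that] by (rule order_trans) (intro mult_right_mono, auto)
  then show ?thesis by (intro exI[of _ "\<bar>C\<bar>"]) auto
qed

text \<open>Linearity alone suffices for finite support. Since responses start from zero history,
  this lets them be computed without passing to limits inside \<open>L n\<close>.\<close>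

lemma L_finite:
  assumes "\<And>j. N \<le> j \<Longrightarrow> \<phi> j = 0"
  shows "L n \<phi> = (\<Sum>j<N. L n (single j (\<phi> j)))"
  using assms
proof (induction N arbitrary: \<phi>)
  case 0
  then have "\<phi> = (\<lambda>_. 0)" by auto
  then show ?case by simp
next
  case (Suc N)
  let ?\<psi> = "\<lambda>j. if j < N then \<phi> j else 0"
  have "?\<psi> \<in> B" by (rule phase_space_finite[of N]) auto
  have "\<phi> = (\<lambda>j. 1 *\<^sub>R ?\<psi> j + 1 *\<^sub>R single N (\<phi> N) j)"
    using Suc.prems by (auto simp: fun_eq_iff single_def not_less)
  then have "L n \<phi> = L n ?\<psi> + L n (single N (\<phi> N))"
    using L_comb[OF \<open>?\<psi> \<in> B\<close>, of "single N (\<phi> N)" n 1 1] by simp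
  also have "L n ?\<psi> = (\<Sum>j<N. L n (single j (\<phi> j)))"
    using Suc.IH[of ?\<psi>] by simp
  finally show ?case by simp
qed

lemma bounded_linear_L_single: "bounded_linear (\<lambda>v. L n (single j v))"
proof -
  obtain C where C: "0 \<le> C" "\<forall>\<phi>\<in>B. norm (L n \<phi>) \<le> C * pn \<phi>" using L_bound by blast
  have comb: "L n (single j (a *\<^sub>R v + b *\<^sub>R w)) = a *\<^sub>R L n (single j v) + b *\<^sub>R L n (single j w)" for a b v w
  proof -
    have "single j (a *\<^sub>R v + b *\<^sub>R w) = (\<lambda>i. a *\<^sub>R single j v i + b *\<^sub>R single j w i)"
      by (auto simp: single_def)
    then show ?thesis by (simp add: L_comb)
  qed
  show ?thesis
  proof (rule bounded_linear_intro)
    show "L n (single j (v + w)) = L n (single j v) + L n (single j w)" for v w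
      using comb[of 1 v 1 w] by simp
    show "L n (single j (c *\<^sub>R v)) = c *\<^sub>R L n (single j v)" for c v
      using comb[of c v 0 0] by simp
    show "norm (L n (single j v)) \<le> norm v * C" for v
    proof -
      have "norm (L n (single j v)) \<le> C * pn (single j v)" using C by simp
      also have "\<dots> \<le> C * norm v" by (intro mult_left_mono phase_norm_single_le r \<gamma> C)
      finally show ?thesis by (simp add: mult.commute)
    qed
  qed
qed

section \<open>Linearity, causality and continuity of responses\<close>

lemma prehistory_in_B:
  assumes "\<phi> \<in> B" "\<tau> \<le> n"
  shows "prehistory (solution L \<tau> \<phi> f) (int n) \<in> B"
  using assms(2)
proof (induction n rule: dec_induct)
  case base
  then show ?case using assms(1) by simp
next
  case (step n)
  have "prehistory (solution L \<tau> \<phi> f) (int n + 1) \<in> B"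
    unfolding prehistory_Suc by (rule phase_space_case_nat[OF r step.IH])
  then show ?case by (simp add: add.commute)
qed

lemma solution_comb:
  assumes "\<phi> \<in> B" "\<psi> \<in> B"
  shows "solution L \<tau> (\<lambda>j. a *\<^sub>R \<phi> j + b *\<^sub>R \<psi> j) (\<lambda>n. a *\<^sub>R f n + b *\<^sub>R g n)
    = (\<lambda>i. a *\<^sub>R solution L \<tau> \<phi> f i + b *\<^sub>R solution L \<tau> \<psi> g i)"
proof -
  let ?x = "\<lambda>i. a *\<^sub>R solution L \<tau> \<phi> f i + b *\<^sub>R solution L \<tau> \<psi> g i"
  have pre: "prehistory ?x n = (\<lambda>j. a *\<^sub>R prehistory (solution L \<tau> \<phi> f) n j
      + b *\<^sub>R prehistory (solution L \<tau> \<psi> g) n j)" for n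
    by (simp add: prehistory_def)
  show ?thesis
  proof (rule solution_eqI, unfold is_solution_def, intro conjI allI impI)
    show "prehistory ?x (int \<tau>) = (\<lambda>j. a *\<^sub>R \<phi> j + b *\<^sub>R \<psi> j)"
      by (simp add: pre)
    fix n assume "\<tau> \<le> n"
    then show "?x (int n + 1) = L n (prehistory ?x (int n)) + (a *\<^sub>R f n + b *\<^sub>R g n)"
      unfolding pre using assms
      by (subst L_comb) (simp_all add: prehistory_in_B solution_step scaleR_add_right)
  qed
qed

lemma resp_comb: "resp (\<lambda>n. a *\<^sub>R f n + b *\<^sub>R g n) = (\<lambda>i. a *\<^sub>R resp f i + b *\<^sub>R resp g i)"
  using solution_comb[OF zero_in_B zero_in_B, of 0 a b f g] by simp

lemma resp_scaleR: "resp (\<lambda>n. c *\<^sub>R f n) = (\<lambda>i. c *\<^sub>R resp f i)"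
  using resp_comb[of c f 0 f] by simp

lemma resp_sum:
  fixes N :: nat
  shows "resp (\<lambda>n. \<Sum>k<N. f k n) = (\<lambda>i. \<Sum>k<N. resp (f k) i)"
proof (induction N)
  case 0
  show ?case using resp_scaleR[of 0 "\<lambda>_. 0"] by simp
next
  case (Suc N)
  then show ?case using resp_comb[of 1 "\<lambda>n. \<Sum>k<N. f k n" 1 "f N"] by simp
qed

text \<open>Causality. The bound \<open>i \<le> int k\<close> is not strict because the forcing at
  time k first acts on the value at time k + 1.\<close>

lemma resp_before:
  assumes "\<And>n. n < k \<Longrightarrow> f n = 0" "i \<le> int k"
  shows "resp f i = 0"
proof (cases "i \<le> 0")
  case True
  then show ?thesis using solution_past[of L 0 "\<lambda>_. 0" f "nat (- i)"] by simp
next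
  case False
  have "m \<le> k \<Longrightarrow> \<forall>j. prehistory (resp f) (int m) j = 0" for m
  proof (induction m)
    case 0
    show ?case using prehistory_solution_init[of L 0 "\<lambda>_. 0" f] by simp
  next
    case (Suc m)
    then have "prehistory (resp f) (int m) = (\<lambda>_. 0)" by auto
    then show ?case
      using Suc prehistory_Suc[of "resp f" "int m"] solution_step[of 0 m L "\<lambda>_. 0" f] assms(1)[of m]
      by (auto simp: add.commute split: nat.split)
  qed
  from this[of "nat i"] False assms(2) have "prehistory (resp f) i 0 = 0" by simp
  then show ?thesis by (simp add: prehistory_def)
qed

lemma resp_nonpos: "i \<le> 0 \<Longrightarrow> resp f i = 0"
  using resp_before[of 0] by simp

text \<open>Lag j looks at time n - j, which lies after k exactly when j < n - k; at all other lags
  the response vanishes by causality.\<close>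

lemma resp_step_finite:
  assumes "\<And>n. n < k \<Longrightarrow> f n = 0"
  shows "resp f (int n + 1) = (\<Sum>j<n - k. L n (single j (resp f (int n - int j)))) + f n"
proof -
  have "L n (prehistory (resp f) (int n))
      = (\<Sum>j<n - k. L n (single j (prehistory (resp f) (int n) j)))"
  proof (rule L_finite)
    fix j assume "n - k \<le> j"
    then show "prehistory (resp f) (int n) j = 0"
      unfolding prehistory_def by (intro resp_before[of k]) (auto simp: assms)
  qed
  then show ?thesis by (simp add: solution_step prehistory_def)
qed

text \<open>The recursion builds a response value from finitely many earlier ones by bounded linear
  maps and adds one coordinate of \<open>f\<close>, which is continuous in the product
  topology.\<close>

lemma continuous_resp: "continuous_on UNIV (\<lambda>f. resp f (int n))"
proof (induction n rule: less_induct)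
  case (less n)
  show ?case
  proof (cases n)
    case 0
    then show ?thesis by (simp add: resp_nonpos)
  next
    case (Suc m)
    have "continuous_on UNIV (\<lambda>f. L m (single j (resp f (int m - int j))))" if "j < m" for j
    proof -
      have "continuous_on UNIV (\<lambda>f. resp f (int (m - j)))"
        by (rule less.IH) (use Suc in simp)
      then have "continuous_on UNIV (\<lambda>f. resp f (int m - int j))"
        using that by (simp add: of_nat_diff)
      then show ?thesis
        by (rule bounded_linear.continuous_on[OF bounded_linear_L_single])
    qed
    then have "continuous_on UNIV (\<lambda>f. (\<Sum>j<m. L m (single j (resp f (int m - int j)))) + f m)"
      by (intro continuous_on_add continuous_on_sum continuous_on_product_coordinates) auto
    then show ?thesis
      using resp_step_finite[of 0 _ m] by (simp add: Suc add.commute)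
  qed
qed

lemma resp_quasi:
  assumes "0 < t" "t \<le> 1"
  shows "norm (resp g i) \<le> 1 / t * (norm (resp f i) + norm (resp (\<lambda>n. (1 - t) *\<^sub>R f n + t *\<^sub>R g n) i))"
proof -
  let ?h = "resp (\<lambda>n. (1 - t) *\<^sub>R f n + t *\<^sub>R g n) i"
  have "t *\<^sub>R resp g i = ?h - (1 - t) *\<^sub>R resp f i"
    by (simp add: resp_comb)
  then have "t * norm (resp g i) = norm (?h - (1 - t) *\<^sub>R resp f i)"
    using assms by (metis abs_of_pos norm_scaleR)
  also have "\<dots> \<le> norm ?h + norm ((1 - t) *\<^sub>R resp f i)" by (rule norm_triangle_ineq4)
  also have "norm ((1 - t) *\<^sub>R resp f i) \<le> 1 * norm (resp f i)"
    unfolding norm_scaleR using assms by (intro mult_right_mono) auto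
  finally show ?thesis using assms by (simp add: field_simps)
qed

lemma lp_linf_bound:
  assumes p: "1 \<le> p" and stable: "lp_lq_stable p \<infinity> L"
  shows "\<exists>C\<ge>0. \<forall>f\<in>lp_ball p. \<forall>n. norm (resp f (int n)) \<le> C"
proof -
  have "\<exists>C. \<forall>f\<in>lp_ball p. \<forall>n. norm (resp f (int n)) \<le> C"
  \<comment> \<open>The absolute value is there because \<open>H\<close> must be nonnegative for
    every real \<open>t\<close>, not only on the unit interval.\<close>
  proof (rule uniform_boundedness_convex[where R = "\<lambda>_. 1" and H = "\<lambda>t. 1 / \<bar>t\<bar>"])
    show "continuous_on UNIV (\<lambda>f. norm (resp f (int n)))" for n
      by (intro continuous_on_norm continuous_resp)
    fix f :: "nat \<Rightarrow> 'a" assume "f \<in> lp_ball p"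
    then have "f \<in> lp_space p" using lp_ball_subset[OF p] by blast
    then have "(\<lambda>n. resp f (int n)) \<in> lp_space \<infinity>"
      using stable by (auto simp: lp_lq_stable_def)
    then show "\<exists>B. \<forall>n. norm (resp f (int n)) \<le> B"
      by (auto simp: lp_space_def bounded_iff)
  qed (use resp_quasi in \<open>auto intro: lp_ball_closed lp_ball_convex lp_ball_norm_le p simp del: times_divide_eq_left\<close>)
  then obtain C where "\<forall>f\<in>lp_ball p. \<forall>n. norm (resp f (int n)) \<le> C" ..
  then show ?thesis
    by (intro exI[of _ "max 0 C"]) (auto simp: le_max_iff_disj)
qed

lemma lp_lq_bound:
  assumes p: "1 \<le> p" and q: "1 \<le> q" "q \<noteq> \<infinity>" and stable: "lp_lq_stable p q L"
  shows "\<exists>C. \<forall>f\<in>lp_ball p. \<forall>N. (\<Sum>n<N. norm (resp f (int n)) powr real_of_ereal q) \<le> C"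
proof -
  define s where "s = real_of_ereal q"
  have s: "1 \<le> s" using real_of_ereal_ge_1[OF q] by (simp add: s_def)
  have "\<exists>C. \<forall>f\<in>lp_ball p. \<forall>N. (\<Sum>n<N. norm (resp f (int n)) powr s) \<le> C"
  \<comment> \<open>The family is indexed by the length of the partial sum. The factor
    \<open>1 / t\<close> comes from \<open>resp_quasi\<close>, \<open>2 powr s\<close> from the
    quasi-triangle inequality \<open>add_powr_le\<close>.\<close>
  proof (rule uniform_boundedness_convex[where R = "\<lambda>_. 1" and H = "\<lambda>t. (1 / t) powr s * 2 powr s"])
    show "continuous_on UNIV (\<lambda>f. \<Sum>n<N. norm (resp f (int n)) powr s)" for N
      using s by (intro continuous_on_sum continuous_on_powr' continuous_on_norm continuous_resp continuous_on_const) auto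
  next
    fix f :: "nat \<Rightarrow> 'a" assume "f \<in> lp_ball p"
    then have "f \<in> lp_space p" using lp_ball_subset[OF p] by blast
    then have "(\<lambda>n. resp f (int n)) \<in> lp_space q"
      using stable by (auto simp: lp_lq_stable_def)
    then have "summable (\<lambda>n. norm (resp f (int n)) powr s)"
      using q by (simp add: lp_space_def s_def)
    then show "\<exists>B. \<forall>N. (\<Sum>n<N. norm (resp f (int n)) powr s) \<le> B"
      by (intro exI[of _ "\<Sum>n. norm (resp f (int n)) powr s"] allI sum_le_suminf) auto
  next
    fix N :: nat and f g :: "nat \<Rightarrow> 'a" and t :: real
    assume t: "0 < t" "t \<le> 1"
    let ?h = "\<lambda>n. (1 - t) *\<^sub>R f n + t *\<^sub>R g n"
    have "norm (resp g i) powr s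
        \<le> (1 / t) powr s * 2 powr s * (norm (resp f i) powr s + norm (resp ?h i) powr s)" for i
    proof -
      have "norm (resp g i) powr s \<le> (1 / t * (norm (resp f i) + norm (resp ?h i))) powr s"
        using s resp_quasi[OF t] by (intro powr_mono2) auto
      also have "\<dots> = (1 / t) powr s * (norm (resp f i) + norm (resp ?h i)) powr s"
        by (rule powr_mult)
      also have "\<dots> \<le> (1 / t) powr s * (2 powr s * (norm (resp f i) powr s + norm (resp ?h i) powr s))"
        using s by (intro mult_left_mono add_powr_le) auto
      finally show ?thesis by (simp only: mult.assoc)
    qed
    then show "(\<Sum>n<N. norm (resp g (int n)) powr s) \<le> (1 / t) powr s * 2 powr s *
        ((\<Sum>n<N. norm (resp f (int n)) powr s) + (\<Sum>n<N. norm (resp ?h (int n)) powr s))"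
      unfolding sum.distrib[symmetric] sum_distrib_left by (intro sum_mono)
  qed (auto intro: lp_ball_closed lp_ball_convex lp_ball_norm_le p)
  then show ?thesis by (simp add: s_def)
qed

section \<open>Uniform bounds for the operators\<close>

lemma condition_B_bound:
  assumes "condition_B r \<gamma> L"
  shows "\<exists>N S. \<forall>n. \<forall>\<phi>\<in>B. norm (L n (tail_proj (- int N) \<phi>)) \<le> S * pn \<phi>"
proof -
  obtain m S where m: "m \<le> 0" and S: "\<And>n. phase_onorm r \<gamma> (L n \<circ> tail_proj m) \<le> S"
    using assms by (auto simp: condition_B_def bdd_above_def)
  have "norm (L n (tail_proj m \<phi>)) \<le> S * pn \<phi>" if \<phi>: "\<phi> \<in> B" for n \<phi>
  proof -
    obtain C where C: "0 \<le> C" "\<forall>\<phi>\<in>B. norm (L n \<phi>) \<le> C * pn \<phi>" using L_bound by blast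
    have le: "norm (L n (tail_proj m \<psi>)) \<le> C * pn \<psi>" if "\<psi> \<in> B" for \<psi>
    proof -
      have "tail_proj m \<psi> \<in> B"
        by (rule phase_space_mono[OF r that]) (simp add: tail_proj_def)
      moreover have "pn (tail_proj m \<psi>) \<le> pn \<psi>"
        by (rule phase_norm_mono[OF r that]) (simp add: tail_proj_def)
      ultimately show ?thesis using C by (meson mult_left_mono order_trans)
    qed
    show ?thesis
    \<comment> \<open>A quotient by zero is 0 and says nothing about its numerator, so this case
      uses the n-dependent bound \<open>C\<close>.\<close>
    proof (cases "pn \<phi> = 0")
      case True
      then show ?thesis using le[OF \<phi>] by simp
    next
      case False
      then have pos: "0 < pn \<phi>" by (simp add: less_le)
      \<comment> \<open>A real supremum dominates its members only if they are bounded above.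
        \<open>C\<close> ensures this for each \<open>n\<close>; the resulting constant is still the
        uniform \<open>S\<close>.\<close>
      have "bdd_above ((\<lambda>\<psi>. norm ((L n \<circ> tail_proj m) \<psi>) / pn \<psi>) ` B)"
      proof (rule bdd_aboveI2)
        fix \<psi> assume "\<psi> \<in> B"
        then show "norm ((L n \<circ> tail_proj m) \<psi>) / pn \<psi> \<le> C"
          using le[of \<psi>] C(1) by (cases "pn \<psi> = 0") (auto simp: divide_le_eq less_le)
      qed
      then have "norm ((L n \<circ> tail_proj m) \<phi>) / pn \<phi> \<le> phase_onorm r \<gamma> (L n \<circ> tail_proj m)"
        unfolding phase_onorm_def by (intro cSUP_upper \<phi>)
      also have "\<dots> \<le> S" by (rule S)
      finally show ?thesis using pos by (simp add: divide_le_eq)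
    qed
  qed
  then show ?thesis using m by (intro exI[of _ "nat (- m)"] exI[of _ S]) simp
qed

text \<open>The response to an impulse \<open>v\<close> at time k takes the value \<open>v\<close>
  at k + 1. At n = k + j + 1 that value sits at lag j, so the next response value is
  \<open>L n (single j v)\<close> plus terms of smaller lag, which the induction bounds.\<close>

lemma L_single_uniform_bound:
  assumes p: "1 \<le> p" and C: "0 \<le> C" "\<forall>f\<in>lp_ball p. \<forall>n. norm (resp f (int n)) \<le> C"
  shows "\<exists>D\<ge>0. \<forall>n v. norm (L n (single j v)) \<le> D * norm v"
proof (induction j rule: less_induct)
  case (less j)
  then obtain D where D: "\<And>i. i < j \<Longrightarrow> 0 \<le> D i"
    "\<And>i n v. i < j \<Longrightarrow> norm (L n (single i v)) \<le> D i * norm v"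
    by metis
  define E where "E = C + (\<Sum>i<j. D i * C)"
  have E: "0 \<le> E" using D(1) C(1) by (auto simp: E_def intro!: add_nonneg_nonneg sum_nonneg)
  have late: "norm (L n (single j v)) \<le> E * norm v" if n: "n = Suc (k + j)" for n k v
  proof -
    let ?f = "single k v"
    have bound: "norm (resp ?f (int i)) \<le> C * norm v" for i
    proof (cases "v = 0")
      case True
      then have "?f = (\<lambda>n. 0 *\<^sub>R 0)" by (auto simp: single_def)
      then show ?thesis using resp_scaleR[of 0 "\<lambda>_. 0"] True by simp
    next
      case False
      let ?g = "single k ((1 / norm v) *\<^sub>R v)"
      have "(\<lambda>n. (1 / 1 powr (if p = \<infinity> then 0 else 1 / real_of_ereal p)) *\<^sub>R ?g n) \<in> lp_ball p"
        using False
        by (intro lp_ballI_sum p) (auto simp: single_def if_distrib[where f = norm] cong: if_cong)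
      then have "?g \<in> lp_ball p" by simp
      then have "norm v * norm (resp ?g (int i)) \<le> norm v * C"
        using C(2) by (intro mult_left_mono) auto
      moreover have "?f = (\<lambda>n. norm v *\<^sub>R ?g n)" using False by (auto simp: single_def)
      then have "norm (resp ?f (int i)) = norm v * norm (resp ?g (int i))"
        by (simp only: resp_scaleR norm_scaleR abs_norm_cancel)
      ultimately show ?thesis by (simp only: mult.commute)
    qed
    have "resp ?f (int k + 1) = v"
      using resp_step_finite[of k ?f k] by (simp add: single_def)
    moreover have "int n - int j = int k + 1" using n by simp
    ultimately have v: "resp ?f (int n - int j) = v" by simp
    have "?f m = 0" if "m < k" for m using that by (simp add: single_def)
    moreover have "?f n = 0" "n - k = Suc j" using n by (simp_all add: single_def)
    ultimately have "resp ?f (int n + 1)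
        = (\<Sum>i<j. L n (single i (resp ?f (int n - int i)))) + L n (single j v)"
      using resp_step_finite[of k ?f n] by (simp only: sum.lessThan_Suc v add_0_right)
    then have "L n (single j v) = resp ?f (int (Suc n)) - (\<Sum>i<j. L n (single i (resp ?f (int n - int i))))"
      by (simp add: add.commute)
    also have "norm \<dots> \<le> C * norm v + (\<Sum>i<j. D i * (C * norm v))"
    proof (rule order_trans[OF norm_triangle_ineq4], rule add_mono[OF bound], rule sum_norm_le)
      fix i assume i: "i \<in> {..<j}"
      then have eq: "int n - int i = int (n - i)" using n by simp
      have "norm (L n (single i (resp ?f (int n - int i)))) \<le> D i * norm (resp ?f (int n - int i))"
        using D(2) i by simp
      also have "\<dots> \<le> D i * (C * norm v)"
        unfolding eq using D(1) i by (intro mult_left_mono bound) auto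
      finally show "norm (L n (single i (resp ?f (int n - int i)))) \<le> D i * (C * norm v)" .
    qed
    also have "\<dots> = E * norm v"
      by (simp add: E_def distrib_right sum_distrib_right mult.assoc)
    finally show ?thesis .
  qed
  \<comment> \<open>Impulses start at time 0 or later and do not reach \<open>n \<le> j\<close>;
    these finitely many operators are bounded by their own norms.\<close>
  define F where "F = E + (\<Sum>n\<le>j. onorm (\<lambda>v. L n (single j v)))"
  have on: "0 \<le> onorm (\<lambda>v. L n (single j v))" for n
    by (rule onorm_pos_le[OF bounded_linear_L_single])
  have "norm (L n (single j v)) \<le> F * norm v" for n v
  proof (cases "n \<le> j")
    case True
    then have "onorm (\<lambda>v. L n (single j v)) \<le> F"
      using E on by (auto simp: F_def intro!: add_increasing member_le_sum)
    with onorm[OF bounded_linear_L_single, of n j v] show ?thesis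
      by (meson mult_right_mono norm_ge_zero order_trans)
  next
    case False
    then have "norm (L n (single j v)) \<le> E * norm v" by (intro late[of _ "n - j - 1"]) auto
    also have "\<dots> \<le> F * norm v" using on by (intro mult_right_mono) (auto simp: F_def sum_nonneg)
    finally show ?thesis .
  qed
  moreover have "0 \<le> F" using E on by (auto simp: F_def intro!: add_nonneg_nonneg sum_nonneg)
  ultimately show ?case by blast
qed

text \<open>(B) handles lags from \<open>N\<close> on, impulses the finitely many lags below. The
  weight \<open>exp (\<gamma> * real j)\<close> is the cost of bounding one coordinate by the phase
  norm.\<close>

lemma L_uniform_bound:
  assumes p: "1 \<le> p" and C: "0 \<le> C" "\<forall>f\<in>lp_ball p. \<forall>n. norm (resp f (int n)) \<le> C"
    and condB: "condition_B r \<gamma> L"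
  shows "\<exists>M\<ge>0. \<forall>n. \<forall>\<phi>\<in>B. norm (L n \<phi>) \<le> M * pn \<phi>"
proof -
  obtain N S where S: "\<And>n \<phi>. \<phi> \<in> B \<Longrightarrow> norm (L n (tail_proj (- int N) \<phi>)) \<le> S * pn \<phi>"
    using condition_B_bound[OF condB] by blast
  obtain D where D: "\<And>j. 0 \<le> D j" "\<And>j n v. norm (L n (single j v)) \<le> D j * norm v"
    using L_single_uniform_bound[OF p C] by metis
  define M where "M = (\<Sum>j<N. D j * exp (\<gamma> * real j)) + \<bar>S\<bar>"
  have "norm (L n \<phi>) \<le> M * pn \<phi>" if \<phi>: "\<phi> \<in> B" for n \<phi>
  proof -
    let ?h = "\<lambda>j. if j < N then \<phi> j else 0" and ?t = "tail_proj (- int N) \<phi>"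
    have "?h \<in> B"
      by (rule phase_space_mono[OF r \<phi>]) simp
    moreover have "?t \<in> B"
      by (rule phase_space_mono[OF r \<phi>]) (simp add: tail_proj_def)
    moreover have "\<phi> = (\<lambda>j. 1 *\<^sub>R ?h j + 1 *\<^sub>R ?t j)" by (auto simp: tail_proj_def)
    ultimately have "L n \<phi> = L n ?h + L n ?t"
      using L_comb[of ?h ?t n 1 1] by simp
    also have "L n ?h = (\<Sum>j<N. L n (single j (\<phi> j)))"
      using L_finite[of N ?h n] by simp
    finally have "norm (L n \<phi>) \<le> norm (\<Sum>j<N. L n (single j (\<phi> j))) + norm (L n ?t)"
      by (simp add: norm_triangle_ineq)
    also have "\<dots> \<le> (\<Sum>j<N. D j * exp (\<gamma> * real j) * pn \<phi>) + \<bar>S\<bar> * pn \<phi>"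
    proof (rule add_mono, rule sum_norm_le)
      fix j
      have "norm (L n (single j (\<phi> j))) \<le> D j * norm (\<phi> j)" by (rule D)
      also have "\<dots> \<le> D j * (exp (\<gamma> * real j) * pn \<phi>)"
        by (intro mult_left_mono norm_coord_le_phase_norm r \<phi> D)
      finally show "norm (L n (single j (\<phi> j))) \<le> D j * exp (\<gamma> * real j) * pn \<phi>"
        by (simp only: mult.assoc)
    next
      show "norm (L n ?t) \<le> \<bar>S\<bar> * pn \<phi>"
        by (rule order_trans[OF S[OF \<phi>]]) (intro mult_right_mono, auto)
    qed
    also have "\<dots> = M * pn \<phi>" by (simp add: M_def distrib_right sum_distrib_right)
    finally show ?thesis .
  qed
  moreover have "0 \<le> M" using D(1) by (auto simp: M_def intro!: add_nonneg_nonneg sum_nonneg)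
  ultimately show ?thesis by blast
qed

section \<open>Growth estimates for homogeneous solutions\<close>

text \<open>One rate parameter covers both notions, with \<nu> = 0 for uniform stability; the
  elapsed time \<open>k\<close> stands for n - \<tau>.\<close>

definition growth_X :: "real \<Rightarrow> real \<Rightarrow> bool" where
  "growth_X K \<nu> \<longleftrightarrow> (\<forall>\<tau> k. \<forall>\<phi>\<in>B. norm (hom \<tau> \<phi> (int (\<tau> + k))) \<le> K * exp (- \<nu> * real k) * pn \<phi>)"

definition growth_B :: "real \<Rightarrow> real \<Rightarrow> bool" where
  "growth_B K \<nu> \<longleftrightarrow>
     (\<forall>\<tau> k. \<forall>\<phi>\<in>B. pn (prehistory (hom \<tau> \<phi>) (int (\<tau> + k))) \<le> K * exp (- \<nu> * real k) * pn \<phi>)"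

lemma unif_exp_stable_X_iff: "unif_exp_stable_X r \<gamma> L \<longleftrightarrow> (\<exists>K\<ge>1. \<exists>\<nu>>0. growth_X K \<nu>)"
  unfolding unif_exp_stable_X_def growth_X_def all_le_iff by simp

lemma unif_exp_stable_B_iff: "unif_exp_stable_B r \<gamma> L \<longleftrightarrow> (\<exists>K\<ge>1. \<exists>\<nu>>0. growth_B K \<nu>)"
  unfolding unif_exp_stable_B_def growth_B_def all_le_iff by simp

lemma unif_stable_X_iff: "unif_stable_X r \<gamma> L \<longleftrightarrow> (\<exists>K\<ge>1. growth_X K 0)"
  unfolding unif_stable_X_def growth_X_def all_le_iff by simp

lemma unif_stable_B_iff: "unif_stable_B r \<gamma> L \<longleftrightarrow> (\<exists>K\<ge>1. growth_B K 0)"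
  unfolding unif_stable_B_def growth_B_def all_le_iff by simp

lemma norm_le_pn_prehistory:
  assumes "\<phi> \<in> B" "\<tau> \<le> n"
  shows "norm (solution L \<tau> \<phi> f (int n)) \<le> pn (prehistory (solution L \<tau> \<phi> f) (int n))"
  using norm_coord_le_phase_norm[OF r prehistory_in_B[OF assms, of f], of 0]
  by (simp add: prehistory_def)

lemma pn_prehistory_Suc:
  assumes "\<phi> \<in> B" "\<tau> \<le> n"
  shows "pn (prehistory (solution L \<tau> \<phi> f) (int (Suc n)))
    \<le> norm (solution L \<tau> \<phi> f (int (Suc n))) + exp (- \<gamma>) * pn (prehistory (solution L \<tau> \<phi> f) (int n))"
  using phase_norm_case_nat[OF r prehistory_in_B[OF assms, of f], of "solution L \<tau> \<phi> f (int n + 1)"]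
    prehistory_Suc[of "solution L \<tau> \<phi> f" "int n"]
  by (simp add: add.commute)

lemma growth_X_if_growth_B: "growth_B K \<nu> \<Longrightarrow> growth_X K \<nu>"
  unfolding growth_X_def growth_B_def using norm_le_pn_prehistory le_add1 order_trans by meson

lemma growth_X_mono:
  assumes "growth_X K \<nu>" "\<nu>' \<le> \<nu>" "0 \<le> K"
  shows "growth_X K \<nu>'"
  unfolding growth_X_def
proof (intro allI ballI)
  fix \<tau> k \<phi> assume \<phi>: "\<phi> \<in> B"
  have "K * exp (- \<nu> * real k) * pn \<phi> \<le> K * exp (- \<nu>' * real k) * pn \<phi>"
    using assms by (intro mult_right_mono mult_left_mono) (auto simp: mult_right_mono)
  with \<phi> show "norm (hom \<tau> \<phi> (int (\<tau> + k))) \<le> K * exp (- \<nu>' * real k) * pn \<phi>"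
    using assms(1) unfolding growth_X_def by (meson order_trans)
qed

text \<open>A prehistory forgets old values at rate \<gamma>, so it can inherit rates \<nu> <
  \<gamma>. \<open>D\<close> is the fixed point of \<open>D = K + e * D\<close>, which makes the
  induction step reproduce its own constant.\<close>

lemma growth_B_if_growth_X:
  assumes X: "growth_X K \<nu>" and K: "1 \<le> K" and \<nu>: "\<nu> < \<gamma>"
  shows "\<exists>D\<ge>1. growth_B D \<nu>"
proof -
  define e where "e = exp (\<nu> - \<gamma>)"
  have e: "0 < e" "e < 1" using \<nu> by (auto simp: e_def)
  define D where "D = K / (1 - e)"
  have D: "K + e * D = D" "1 \<le> D"
    using e K by (auto simp: D_def field_simps)
  have "pn (prehistory (hom \<tau> \<phi>) (int (\<tau> + k))) \<le> D * exp (- \<nu> * real k) * pn \<phi>"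
    if \<phi>: "\<phi> \<in> B" for \<tau> k \<phi>
  proof (induction k)
    case 0
    then show ?case using D(2) mult_right_mono[of 1 D "pn \<phi>"] by simp
  next
    case (Suc k)
    have "pn (prehistory (hom \<tau> \<phi>) (int (Suc (\<tau> + k))))
        \<le> norm (hom \<tau> \<phi> (int (Suc (\<tau> + k)))) + exp (- \<gamma>) * pn (prehistory (hom \<tau> \<phi>) (int (\<tau> + k)))"
      by (rule pn_prehistory_Suc[OF \<phi>]) simp
    also have "\<dots> \<le> K * exp (- \<nu> * real (Suc k)) * pn \<phi> + exp (- \<gamma>) * (D * exp (- \<nu> * real k) * pn \<phi>)"
    proof (intro add_mono mult_left_mono Suc)
      show "norm (hom \<tau> \<phi> (int (Suc (\<tau> + k)))) \<le> K * exp (- \<nu> * real (Suc k)) * pn \<phi>"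
        using X \<phi> unfolding growth_X_def add_Suc_right[symmetric] by blast
    qed simp
    also have "exp (- \<gamma>) * (D * exp (- \<nu> * real k) * pn \<phi>) = e * D * exp (- \<nu> * real (Suc k)) * pn \<phi>"
    proof -
      have "exp (- \<gamma>) * exp (- \<nu> * real k) = e * exp (- \<nu> * real (Suc k))"
        by (simp add: e_def algebra_simps flip: exp_add)
      then show ?thesis by (simp add: mult_ac)
    qed
    also have "K * exp (- \<nu> * real (Suc k)) * pn \<phi> + e * D * exp (- \<nu> * real (Suc k)) * pn \<phi>
        = (K + e * D) * exp (- \<nu> * real (Suc k)) * pn \<phi>"
      by (simp only: distrib_right)
    finally show ?case by (simp only: D(1) add_Suc_right)
  qed
  with D(2) show ?thesis unfolding growth_B_def by blast
qed

lemma exp_stable_X_imp_B: "unif_exp_stable_X r \<gamma> L \<Longrightarrow> unif_exp_stable_B r \<gamma> L"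
proof -
  assume "unif_exp_stable_X r \<gamma> L"
  then obtain K \<nu> where K: "1 \<le> K" "0 < \<nu>" "growth_X K \<nu>" by (auto simp: unif_exp_stable_X_iff)
  \<comment> \<open>The rate is lowered to stay strictly below \<gamma>.\<close>
  define \<nu>' where "\<nu>' = min \<nu> (\<gamma> / 2)"
  have "growth_X K \<nu>'" by (rule growth_X_mono[OF K(3)]) (use K in \<open>auto simp: \<nu>'_def\<close>)
  then have "\<exists>D\<ge>1. growth_B D \<nu>'"
    by (rule growth_B_if_growth_X) (use K \<gamma> in \<open>auto simp: \<nu>'_def\<close>)
  moreover have "0 < \<nu>'" using K \<gamma> by (simp add: \<nu>'_def)
  ultimately show ?thesis by (auto simp: unif_exp_stable_B_iff)
qed

lemma exp_stable_B_imp_X: "unif_exp_stable_B r \<gamma> L \<Longrightarrow> unif_exp_stable_X r \<gamma> L"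
  unfolding unif_exp_stable_B_iff unif_exp_stable_X_iff using growth_X_if_growth_B by blast

lemma stable_X_iff_B: "unif_stable_X r \<gamma> L \<longleftrightarrow> unif_stable_B r \<gamma> L"
  unfolding unif_stable_B_iff unif_stable_X_iff
  using growth_X_if_growth_B growth_B_if_growth_X \<gamma> by blast

section \<open>Cut-off trajectories and uniform stability\<close>

definition cutoff :: "nat \<Rightarrow> (nat \<Rightarrow> 'a) \<Rightarrow> int \<Rightarrow> 'a" where
  "cutoff \<tau> \<phi> i = (if int \<tau> < i then hom \<tau> \<phi> i else 0)"

text \<open>The strict inequality in \<open>cutoff\<close> matters: with it the sequence vanishes up
  to time \<tau>, hence on all nonpositive integers even when \<tau> = 0.\<close>

lemma resp_residual_cutoff: "resp (residual L (cutoff \<tau> \<phi>)) = cutoff \<tau> \<phi>"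
  by (rule solution_residual) (simp add: cutoff_def)

text \<open>From time \<tau> on, the true and the cut-off prehistory differ by \<open>?d\<close>,
  the initial history pushed back n - \<tau> places. The trajectory is homogeneous, so the residual
  is \<open>L n ?d\<close>, and the shift makes \<open>?d\<close> exponentially small.\<close>

lemma residual_cutoff:
  assumes \<phi>: "\<phi> \<in> B" and M: "\<forall>n. \<forall>\<phi>\<in>B. norm (L n \<phi>) \<le> M * pn \<phi>" "0 \<le> M"
  shows "norm (residual L (cutoff \<tau> \<phi>) n) \<le> (if n < \<tau> then 0 else M * pn \<phi> * exp (- \<gamma> * real (n - \<tau>)))"
proof (cases "n < \<tau>")
  case True
  then have "prehistory (cutoff \<tau> \<phi>) (int n) = (\<lambda>_. 0)" "cutoff \<tau> \<phi> (int n + 1) = 0"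
    by (auto simp: prehistory_def cutoff_def)
  with True show ?thesis by (simp add: residual_def)
next
  case False
  then have n: "\<tau> \<le> n" by simp
  let ?d = "\<lambda>j. if j < n - \<tau> then 0 else \<phi> (j - (n - \<tau>))"
  have past: "hom \<tau> \<phi> (int n - int j) = \<phi> (j - (n - \<tau>))" if "n - \<tau> \<le> j" for j
  proof -
    have "int n - int j = int \<tau> - int (j - (n - \<tau>))" using that n by simp
    then show ?thesis by (simp only: solution_past)
  qed
  have pre: "prehistory (cutoff \<tau> \<phi>) (int n)
      = (\<lambda>j. 1 *\<^sub>R prehistory (hom \<tau> \<phi>) (int n) j + (- 1) *\<^sub>R ?d j)"
    using n past by (auto simp: prehistory_def cutoff_def fun_eq_iff)
  have d: "?d \<in> B" by (rule phase_space_shift[OF r \<phi>])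
  have "L n (prehistory (cutoff \<tau> \<phi>) (int n)) = L n (prehistory (hom \<tau> \<phi>) (int n)) - L n ?d"
    unfolding pre by (subst L_comb[OF prehistory_in_B[OF \<phi> n] d]) simp
  moreover have "cutoff \<tau> \<phi> (int n + 1) = L n (prehistory (hom \<tau> \<phi>) (int n))"
    using n solution_step[OF n, of L \<phi> "\<lambda>_. 0"] by (simp add: cutoff_def)
  ultimately have "residual L (cutoff \<tau> \<phi>) n = L n ?d"
    by (simp add: residual_def)
  then have "norm (residual L (cutoff \<tau> \<phi>) n) \<le> M * pn ?d"
    using M(1) d by (simp only:)
  also have "\<dots> \<le> M * (exp (- \<gamma> * real (n - \<tau>)) * pn \<phi>)"
    by (intro mult_left_mono phase_norm_shift[OF r \<phi>] M)
  finally show ?thesis using False by (simp add: mult_ac)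
qed

text \<open>The scalar is the sum of the geometric series bounding the residual in l1. An l1 norm of
  at most 1 places \<open>g\<close> in the unit ball for every \<open>p\<close>.\<close>

lemma residual_cutoff_in_ball:
  assumes p: "1 \<le> p" and \<phi>: "\<phi> \<in> B" and M: "\<forall>n. \<forall>\<phi>\<in>B. norm (L n \<phi>) \<le> M * pn \<phi>" "0 \<le> M"
  shows "\<exists>g\<in>lp_ball p. residual L (cutoff \<tau> \<phi>) = (\<lambda>n. (M * pn \<phi> / (1 - exp (- \<gamma>))) *\<^sub>R g n)"
proof -
  let ?f = "residual L (cutoff \<tau> \<phi>)"
  define A where "A = M * pn \<phi> / (1 - exp (- \<gamma>))"
  have A: "0 \<le> A" using M(2) \<gamma> by (simp add: A_def)
  have sum: "(\<Sum>n<N. norm (?f n)) \<le> A" for N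
  proof -
    have "(\<Sum>n<N. norm (?f n))
        \<le> (\<Sum>n<N. M * pn \<phi> * (if n < \<tau> then 0 else exp (- \<gamma> * real (n - \<tau>))))"
    proof (rule sum_mono)
      show "norm (?f n) \<le> M * pn \<phi> * (if n < \<tau> then 0 else exp (- \<gamma> * real (n - \<tau>)))" for n
        using residual_cutoff[OF \<phi> M, of \<tau> n] by (cases "n < \<tau>") simp_all
    qed
    also have "\<dots> \<le> M * pn \<phi> * (1 / (1 - exp (- \<gamma>)))"
      unfolding sum_distrib_left[symmetric]
      by (intro mult_left_mono sum_exp_neg_shift_le \<gamma>) (simp add: M)
    finally show ?thesis by (simp add: A_def)
  qed
  define g where "g n = (1 / A) *\<^sub>R ?f n" for n
  have sum_g: "(\<Sum>n<N. norm (g n)) \<le> 1" for N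
  proof -
    have "(\<Sum>n<N. norm (g n)) = (\<Sum>n<N. norm (?f n)) / A"
      using A by (simp add: g_def sum_divide_distrib)
    also have "\<dots> \<le> 1" using sum[of N] A by (cases "A = 0") (auto simp: divide_le_eq)
    finally show ?thesis .
  qed
  have "norm (g n) \<le> (\<Sum>n<Suc n. norm (g n))" for n by (simp add: sum_nonneg)
  then have "norm (g n) \<le> 1" for n using sum_g order_trans by blast
  then have "g \<in> lp_ball p" using lp_ballI_sum[OF p, of g 1] sum_g by simp
  moreover have "?f n = A *\<^sub>R g n" for n
  proof (cases "A = 0")
    case True
    have "norm (?f n) \<le> (\<Sum>n<Suc n. norm (?f n))" by (simp add: sum_nonneg)
    with True sum[of "Suc n"] have "norm (?f n) \<le> 0" by linarith
    with True show ?thesis by simp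
  qed (simp add: g_def)
  ultimately show ?thesis unfolding A_def by blast
qed

lemma growth_X_bounded:
  assumes p: "1 \<le> p" and C: "0 \<le> C" "\<forall>f\<in>lp_ball p. \<forall>n. norm (resp f (int n)) \<le> C"
    and M: "\<forall>n. \<forall>\<phi>\<in>B. norm (L n \<phi>) \<le> M * pn \<phi>" "0 \<le> M"
  shows "\<exists>K\<ge>1. growth_X K 0"
proof -
  define K where "K = max 1 (M / (1 - exp (- \<gamma>)) * C)"
  have "norm (hom \<tau> \<phi> (int (\<tau> + k))) \<le> K * pn \<phi>" if \<phi>: "\<phi> \<in> B" for \<tau> k \<phi>
  \<comment> \<open>The cut-off vanishes at the initial time itself, which is covered by
    \<open>K \<ge> 1\<close> instead.\<close>
  proof (cases "k = 0")
    case True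
    have "norm (hom \<tau> \<phi> (int \<tau>)) \<le> 1 * pn \<phi>"
      using norm_le_pn_prehistory[OF \<phi> order_refl, of \<tau> "\<lambda>_. 0"] by simp
    also have "\<dots> \<le> K * pn \<phi>" by (intro mult_right_mono) (auto simp: K_def)
    finally show ?thesis using True by simp
  next
    case False
    let ?A = "M * pn \<phi> / (1 - exp (- \<gamma>))"
    have A: "0 \<le> ?A" using M(2) \<gamma> by simp
    obtain g where g: "g \<in> lp_ball p" "residual L (cutoff \<tau> \<phi>) = (\<lambda>n. ?A *\<^sub>R g n)"
      using residual_cutoff_in_ball[OF p \<phi> M] by blast
    have "hom \<tau> \<phi> (int (\<tau> + k)) = ?A *\<^sub>R resp g (int (\<tau> + k))"
      using fun_cong[OF resp_residual_cutoff[of \<tau> \<phi>], of "int (\<tau> + k)"] False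
      unfolding g(2) resp_scaleR by (simp add: cutoff_def)
    then have "norm (hom \<tau> \<phi> (int (\<tau> + k))) = ?A * norm (resp g (int (\<tau> + k)))"
      using A by (simp only: norm_scaleR abs_of_nonneg)
    also have "\<dots> \<le> ?A * C" using C(2) g(1) A by (intro mult_left_mono) blast+
    also have "\<dots> = M / (1 - exp (- \<gamma>)) * C * pn \<phi>" by simp
    also have "\<dots> \<le> K * pn \<phi>" by (intro mult_right_mono) (auto simp: K_def)
    finally show ?thesis .
  qed
  then show ?thesis by (intro exI[of _ K]) (auto simp: growth_X_def K_def)
qed

text \<open>Under uniform stability it suffices that every solution is small on some window of
  prescribed length that starts within a bounded time: the fading memory then makes the whole
  prehistory small at the end of that window.\<close>

lemma exp_stable_if_small_windows:
  assumes K: "1 \<le> K" "growth_B K 0"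
    and win: "\<And>\<delta> W. 0 < \<delta> \<Longrightarrow> \<exists>N. \<forall>\<tau>. \<forall>\<phi>\<in>B. \<exists>n\<le>N. \<forall>k. n < k \<longrightarrow> k \<le> n + W \<longrightarrow>
        norm (hom \<tau> \<phi> (int (\<tau> + k))) \<le> \<delta> * pn \<phi>"
  shows "unif_exp_stable_B r \<gamma> L"
proof -
  let ?u = "\<lambda>\<tau> \<phi> k. pn (prehistory (hom \<tau> \<phi>) (int (\<tau> + k)))"
  have stable: "?u \<tau> \<phi> k \<le> K * pn \<phi>" if "\<phi> \<in> B" for \<tau> \<phi> k
    using K(2) that by (simp add: growth_B_def)
  have restart: "hom (\<tau> + k) (prehistory (hom \<tau> \<phi>) (int (\<tau> + k))) = hom \<tau> \<phi>" for \<tau> k \<phi>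
    by (rule solution_restart) simp
  have later: "?u \<tau> \<phi> (k + l) \<le> K * ?u \<tau> \<phi> k" if "\<phi> \<in> B" for \<tau> \<phi> k l
    using stable[OF prehistory_in_B[OF that, of \<tau> "\<tau> + k" "\<lambda>_. 0"], of "\<tau> + k" l]
    unfolding restart by (simp add: add.assoc)
  define e where "e = exp (- \<gamma>)"
  have e: "0 < e" "e < 1" using \<gamma> by (auto simp: e_def)
  \<comment> \<open>Chosen so that the contributions of the window,
    \<open>\<delta> / (1 - e)\<close> after summing the memory, amount to
    \<open>1 / (4 * K)\<close>.\<close>
  define \<delta> where "\<delta> = (1 - e) / (4 * K)"
  have \<delta>: "0 < \<delta>" using e K by (simp add: \<delta>_def)
  \<comment> \<open>The window is long enough to damp the stale prehistory, of size
    \<open>K * pn \<phi>\<close>, to \<open>1 / (4 * K)\<close> as well. The total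
    \<open>1 / (2 * K)\<close> leaves room for one more factor \<open>K\<close> up to time
    \<open>T\<close>.\<close>
  obtain W where W: "e ^ W < 1 / (4 * K * K)"
    using real_arch_pow_inv[of "1 / (4 * K * K)" e] e K by auto
  obtain N where N: "\<forall>\<tau>. \<forall>\<phi>\<in>B. \<exists>n\<le>N. \<forall>k. n < k \<longrightarrow> k \<le> n + W \<longrightarrow>
        norm (hom \<tau> \<phi> (int (\<tau> + k))) \<le> \<delta> * pn \<phi>"
    using win[OF \<delta>] by blast
  \<comment> \<open>\<open>T\<close> exceeds \<open>n + W\<close> for every
    \<open>n \<le> N\<close>, so one period serves all solutions; it is positive even if
    \<open>N\<close> and \<open>W\<close> are 0.\<close>
  define T where "T = Suc (N + W)"
  have half: "?u \<tau> \<phi> T \<le> 1 / 2 * pn \<phi>" if \<phi>: "\<phi> \<in> B" for \<tau> \<phi>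
  proof -
    obtain n where n: "n \<le> N" "\<And>k. n < k \<Longrightarrow> k \<le> n + W \<Longrightarrow> norm (hom \<tau> \<phi> (int (\<tau> + k))) \<le> \<delta> * pn \<phi>"
      using N \<phi> by blast
    have "i \<le> W \<Longrightarrow> ?u \<tau> \<phi> (n + i) \<le> (1 / (4 * K) + e ^ i * K) * pn \<phi>" for i
    proof (induction i)
      case 0
      have "K * pn \<phi> \<le> (1 / (4 * K) + K) * pn \<phi>" using K by (intro mult_right_mono) auto
      then show ?case using stable[OF \<phi>, of \<tau> n] by simp
    next
      case (Suc i)
      have "?u \<tau> \<phi> (n + Suc i) \<le> norm (hom \<tau> \<phi> (int (\<tau> + (n + Suc i)))) + e * ?u \<tau> \<phi> (n + i)"
        using pn_prehistory_Suc[OF \<phi>, of \<tau> "\<tau> + (n + i)" "\<lambda>_. 0"] by (simp add: e_def)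
      also have "\<dots> \<le> \<delta> * pn \<phi> + e * ((1 / (4 * K) + e ^ i * K) * pn \<phi>)"
        using Suc n(2)[of "n + Suc i"] e by (intro add_mono mult_left_mono) auto
      also have "\<dots> = (1 / (4 * K) + e ^ Suc i * K) * pn \<phi>"
        using K by (simp add: \<delta>_def field_simps)
      finally show ?case .
    qed
    then have "?u \<tau> \<phi> (n + W) \<le> (1 / (4 * K) + e ^ W * K) * pn \<phi>" by simp
    also have "\<dots> \<le> (1 / (4 * K) + 1 / (4 * K * K) * K) * pn \<phi>"
      using W K by (intro mult_right_mono add_mono) auto
    also have "\<dots> = 1 / (2 * K) * pn \<phi>" using K by (simp add: field_simps)
    finally have "K * ?u \<tau> \<phi> (n + W) \<le> K * (1 / (2 * K) * pn \<phi>)"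
      using K by (intro mult_left_mono) auto
    moreover have "n + W + (T - (n + W)) = T" using n(1) by (simp add: T_def)
    then have "?u \<tau> \<phi> T \<le> K * ?u \<tau> \<phi> (n + W)"
      using later[OF \<phi>, of \<tau> "n + W" "T - (n + W)"] by (simp only:)
    ultimately show ?thesis using K by simp
  qed
  have pow: "?u \<tau> \<phi> (T * i) \<le> (1 / 2) ^ i * pn \<phi>" if \<phi>: "\<phi> \<in> B" for \<tau> \<phi> i
  proof (induction i)
    case (Suc i)
    have "?u \<tau> \<phi> (T * i + T) \<le> 1 / 2 * ?u \<tau> \<phi> (T * i)"
      using half[OF prehistory_in_B[OF \<phi>, of \<tau> "\<tau> + T * i" "\<lambda>_. 0"], of "\<tau> + T * i"]
      unfolding restart by (simp add: add.assoc)
    with Suc show ?case by (simp add: add.commute)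
  qed simp
  \<comment> \<open>Halving once per \<open>T\<close> steps is the rate \<open>ln 2 / T\<close>.
    Rounding \<open>k\<close> down to a multiple of \<open>T\<close> costs at most one halving,
    hence the factor 2 below; \<open>K\<close> covers the last \<open>k mod T\<close> steps.\<close>
  define \<nu> where "\<nu> = ln 2 / real T"
  have "?u \<tau> \<phi> k \<le> 2 * K * exp (- \<nu> * real k) * pn \<phi>" if \<phi>: "\<phi> \<in> B" for \<tau> \<phi> k
  proof -
    define i where "i = k div T"
    have k: "k = T * i + k mod T" by (simp add: i_def)
    have "k mod T < T" by (simp add: T_def)
    then have "k \<le> T * Suc i" using k by simp
    then have "real k \<le> real T * real (Suc i)" by (metis of_nat_le_iff of_nat_mult)
    then have "real k / real T \<le> real (Suc i)"
      by (simp only: pos_divide_le_eq T_def of_nat_0_less_iff zero_less_Suc mult.commute)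
    then have "ln 2 * (real k / real T) \<le> ln 2 * real (Suc i)"
      by (rule mult_left_mono) simp
    then have "\<nu> * real k \<le> ln 2 * real (Suc i)" by (simp add: \<nu>_def)
    then have "exp (- (ln 2) * real (Suc i)) \<le> exp (- \<nu> * real k)" by simp
    moreover have "exp (- (ln 2) * real (Suc i)) = (1 / 2) ^ Suc i"
      by (subst mult.commute, subst exp_of_nat_mult) (simp add: exp_minus inverse_eq_divide)
    ultimately have "(1 / 2) ^ Suc i \<le> exp (- \<nu> * real k)" by (simp only:)
    then have exp: "(1 / 2) ^ i \<le> 2 * exp (- \<nu> * real k)" by simp
    have "?u \<tau> \<phi> (T * i + k mod T) \<le> K * ?u \<tau> \<phi> (T * i)" by (rule later[OF \<phi>])
    also have "\<dots> \<le> K * ((1 / 2) ^ i * pn \<phi>)"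
      using K by (intro mult_left_mono pow \<phi>) auto
    also have "\<dots> \<le> K * (2 * exp (- \<nu> * real k) * pn \<phi>)"
      using K exp by (intro mult_left_mono mult_right_mono) auto
    finally show ?thesis using k by (simp add: mult_ac)
  qed
  then have "growth_B (2 * K) \<nu>" by (simp add: growth_B_def)
  moreover have "0 < \<nu>" by (simp add: \<nu>_def T_def)
  ultimately show ?thesis using K(1) unfolding unif_exp_stable_B_iff by (intro exI[of _ "2 * K"]) auto
qed

text \<open>Pigeonhole: if each of \<open>J\<close> consecutive blocks of length \<open>W\<close>
  contained a value above \<open>\<delta> * pn \<phi>\<close>, the s-th powers would sum to at least
  \<open>J * (\<delta> * pn \<phi>) powr s\<close>, too much for the uniform bound \<open>C\<close>
  once \<open>J\<close> is large.\<close>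

lemma small_windows_lq:
  assumes p: "1 \<le> p" and s: "0 < s"
    and C: "\<forall>f\<in>lp_ball p. \<forall>N. (\<Sum>n<N. norm (resp f (int n)) powr s) \<le> C"
    and M: "\<forall>n. \<forall>\<phi>\<in>B. norm (L n \<phi>) \<le> M * pn \<phi>" "0 \<le> M"
    and X: "growth_X K 0" and \<delta>: "0 < \<delta>"
  shows "\<exists>N. \<forall>\<tau>. \<forall>\<phi>\<in>B. \<exists>n\<le>N. \<forall>k. n < k \<longrightarrow> k \<le> n + W \<longrightarrow>
        norm (hom \<tau> \<phi> (int (\<tau> + k))) \<le> \<delta> * pn \<phi>"
proof -
  define A where "A = M / (1 - exp (- \<gamma>))"
  have A: "0 \<le> A" using M \<gamma> by (simp add: A_def)
  obtain J :: nat where J: "C * A powr s < real J * \<delta> powr s"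
    using reals_Archimedean3[of "\<delta> powr s"] \<delta> by auto
  have "\<exists>n\<le>J * W. \<forall>k. n < k \<longrightarrow> k \<le> n + W \<longrightarrow> norm (hom \<tau> \<phi> (int (\<tau> + k))) \<le> \<delta> * pn \<phi>"
    if \<phi>: "\<phi> \<in> B" for \<tau> \<phi>
  proof (cases "pn \<phi> = 0")
    case True
    then have "norm (hom \<tau> \<phi> (int (\<tau> + k))) \<le> \<delta> * pn \<phi>" for k
      using X \<phi> unfolding growth_X_def by (metis mult_zero_right)
    then show ?thesis by blast
  next
    case False
    then have pos: "0 < pn \<phi>" by (simp add: less_le)
    show ?thesis
    proof (rule ccontr)
      assume neg: "\<not> ?thesis"
      have "\<exists>k. j * W < k \<and> k \<le> j * W + W \<and> \<delta> * pn \<phi> < norm (hom \<tau> \<phi> (int (\<tau> + k)))" if "j < J" for j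
      proof -
        have "j * W \<le> J * W" using that by simp
        with neg show ?thesis by (meson not_less)
      qed
      then obtain k where k: "\<And>j. j < J \<Longrightarrow> j * W < k j \<and> k j \<le> j * W + W \<and>
          \<delta> * pn \<phi> < norm (hom \<tau> \<phi> (int (\<tau> + k j)))"
        by metis
      \<comment> \<open>The shift by one turns windows of times j * W < k \<le> j * W + W into the
        half-open index blocks that \<open>sum.nat_group\<close> concatenates.\<close>
      define a where "a i = norm (cutoff \<tau> \<phi> (int (\<tau> + Suc i))) powr s" for i
      have block: "(\<delta> * pn \<phi>) powr s \<le> (\<Sum>i\<in>{j * W..<j * W + W}. a i)" if j: "j < J" for j
      proof -
        have "(\<delta> * pn \<phi>) powr s \<le> norm (hom \<tau> \<phi> (int (\<tau> + k j))) powr s"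
          using k[OF j] s \<delta> pos by (intro powr_mono2) auto
        also have "\<dots> = a (k j - 1)"
          using k[OF j] by (simp add: a_def cutoff_def)
        also have "\<dots> \<le> (\<Sum>i\<in>{j * W..<j * W + W}. a i)"
          using k[OF j] by (intro member_le_sum) (auto simp: a_def)
        finally show ?thesis .
      qed
      obtain g where g: "g \<in> lp_ball p" "residual L (cutoff \<tau> \<phi>) = (\<lambda>n. (A * pn \<phi>) *\<^sub>R g n)"
        using residual_cutoff_in_ball[OF p \<phi> M] by (auto simp: A_def)
      have cutoff: "cutoff \<tau> \<phi> = (\<lambda>i. (A * pn \<phi>) *\<^sub>R resp g i)"
        using resp_residual_cutoff[of \<tau> \<phi>] unfolding g(2) resp_scaleR by simp
      have "real J * (\<delta> * pn \<phi>) powr s = (\<Sum>j<J. (\<delta> * pn \<phi>) powr s)" by simp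
      also have "\<dots> \<le> (\<Sum>j<J. \<Sum>i\<in>{j * W..<j * W + W}. a i)"
        using block by (intro sum_mono) auto
      also have "\<dots> = (\<Sum>i<J * W. a i)" by (rule sum.nat_group)
      also have "\<dots> = (\<Sum>n\<in>{Suc \<tau>..<Suc \<tau> + J * W}. norm (cutoff \<tau> \<phi> (int n)) powr s)"
        unfolding a_def
        by (rule sum.reindex_bij_witness[of _ "\<lambda>n. n - Suc \<tau>" "\<lambda>i. \<tau> + Suc i"]) auto
      also have "\<dots> \<le> (\<Sum>n<Suc \<tau> + J * W. norm (cutoff \<tau> \<phi> (int n)) powr s)"
        by (rule sum_mono2) auto
      also have "\<dots> = (A * pn \<phi>) powr s * (\<Sum>n<Suc \<tau> + J * W. norm (resp g (int n)) powr s)"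
      proof -
        have "norm (cutoff \<tau> \<phi> i) powr s = (A * pn \<phi>) powr s * norm (resp g i) powr s" for i
          using A by (simp add: cutoff powr_mult abs_mult)
        then show ?thesis by (simp only: sum_distrib_left)
      qed
      also have "\<dots> \<le> (A * pn \<phi>) powr s * C"
        using C g(1) by (intro mult_left_mono) (blast, simp)
      finally have "real J * \<delta> powr s * pn \<phi> powr s \<le> C * A powr s * pn \<phi> powr s"
        by (simp add: powr_mult mult_ac)
      with J pos show False by simp
    qed
  qed
  then show ?thesis by blast
qed

text \<open>Adding the responses that start to follow the trajectory at the times
  \<open>\<tau>, \<dots>, \<tau> + N - 1\<close> gives a response with value \<open>N\<close> times the trajectory at time \<open>\<tau> + N\<close>,
  while the forcing stays bounded and has \<open>\<ell>\<^sup>1\<close> norm of order \<open>N\<close>,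
  hence \<open>\<ell>\<^sup>p\<close> norm of order \<open>N\<close> to the power \<open>1 / p\<close>.\<close>

lemma hom_decay:
  assumes p: "1 \<le> p" and C: "0 \<le> C" "\<forall>f\<in>lp_ball p. \<forall>n. norm (resp f (int n)) \<le> C"
    and M: "\<forall>n. \<forall>\<phi>\<in>B. norm (L n \<phi>) \<le> M * pn \<phi>" "0 \<le> M"
    and K: "1 \<le> K" "growth_B K 0" and \<phi>: "\<phi> \<in> B" and N: "0 < N"
  shows "real N * norm (hom \<tau> \<phi> (int (\<tau> + N)))
    \<le> M * K / (1 - exp (- \<gamma>)) * C * real N powr (if p = \<infinity> then 0 else 1 / real_of_ereal p) * pn \<phi>"
proof -
  let ?\<theta> = "if p = \<infinity> then 0 else 1 / real_of_ereal p"
  define e where "e = 1 / (1 - exp (- \<gamma>))"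
  have e: "0 < e" using \<gamma> by (simp add: e_def)
  define c where "c = M * K * pn \<phi>"
  define A where "A = c * e"
  have c: "0 \<le> c" using M K by (simp add: c_def)
  then have A: "0 \<le> A" using e by (simp add: A_def)
  define \<psi> where "\<psi> k = prehistory (hom \<tau> \<phi>) (int (\<tau> + k))" for k
  have \<psi>: "\<psi> k \<in> B" "pn (\<psi> k) \<le> K * pn \<phi>" for k
    using prehistory_in_B[OF \<phi>, of \<tau> "\<tau> + k" "\<lambda>_. 0"] K(2) \<phi> by (simp_all add: \<psi>_def growth_B_def)
  have restart: "hom (\<tau> + k) (\<psi> k) = hom \<tau> \<phi>" for k
    unfolding \<psi>_def by (rule solution_restart) simp
  define f where "f k = residual L (cutoff (\<tau> + k) (\<psi> k))" for k
  have f: "norm (f k n) \<le> c * (if n < \<tau> + k then 0 else exp (- \<gamma> * real (n - (\<tau> + k))))" for k n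
  proof -
    have "M * pn (\<psi> k) * exp (- \<gamma> * real (n - (\<tau> + k))) \<le> c * exp (- \<gamma> * real (n - (\<tau> + k)))"
      using mult_left_mono[OF \<psi>(2) M(2)] by (intro mult_right_mono) (auto simp: c_def mult_ac)
    moreover have "norm (f k n) \<le> (if n < \<tau> + k then 0 else M * pn (\<psi> k) * exp (- \<gamma> * real (n - (\<tau> + k))))"
      unfolding f_def by (rule residual_cutoff[OF \<psi>(1) M])
    ultimately show ?thesis
      by (cases "n < \<tau> + k") (simp_all only: if_True if_False mult_zero_right)
  qed
  define g where "g n = (\<Sum>k<N. f k n)" for n
  \<comment> \<open>At a fixed time the \<open>N\<close> forcings have distinct ages n - (\<tau> +
    k), so together they form part of a single geometric series: the bound does not grow with
    \<open>N\<close>.\<close>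
  have g_le: "norm (g n) \<le> A" for n
  proof -
    have "norm (g n) \<le> (\<Sum>k<N. c * (if n < \<tau> + k then 0 else exp (- \<gamma> * real (n - (\<tau> + k)))))"
      unfolding g_def by (intro sum_norm_le f)
    also have "\<dots> = c * (\<Sum>k<N. if n < \<tau> + k then 0 else exp (- \<gamma> * real (n - (\<tau> + k))))"
      by (simp only: sum_distrib_left)
    also have "(\<Sum>k<N. if n < \<tau> + k then 0 else exp (- \<gamma> * real (n - (\<tau> + k))))
        = (\<Sum>k\<in>{k. k < N \<and> \<tau> + k \<le> n}. exp (- \<gamma> * real (n - (\<tau> + k))))"
      by (rule sum.mono_neutral_cong_right) auto
    also have "\<dots> = (\<Sum>i\<in>(\<lambda>k. n - (\<tau> + k)) ` {k. k < N \<and> \<tau> + k \<le> n}. exp (- \<gamma> * real i))"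
      by (subst sum.reindex) (auto simp: inj_on_def)
    also have "\<dots> \<le> (\<Sum>i<Suc n. exp (- \<gamma> * real i))"
      by (rule sum_mono2) auto
    also have "\<dots> \<le> e" unfolding e_def by (rule sum_exp_neg_le[OF \<gamma>])
    finally show ?thesis using c by (simp add: A_def mult_left_mono)
  qed
  \<comment> \<open>Summing over time first instead, each of the \<open>N\<close> forcings
    contributes at most \<open>c * e\<close>.\<close>
  have g_sum: "(\<Sum>n<m. norm (g n)) \<le> A * real N" for m
  proof -
    have "(\<Sum>n<m. norm (g n)) \<le> (\<Sum>n<m. \<Sum>k<N. c * (if n < \<tau> + k then 0 else exp (- \<gamma> * real (n - (\<tau> + k)))))"
      unfolding g_def by (intro sum_mono sum_norm_le f)
    also have "\<dots> = c * (\<Sum>k<N. \<Sum>n<m. if n < \<tau> + k then 0 else exp (- \<gamma> * real (n - (\<tau> + k))))"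
      by (subst sum.swap) (simp only: sum_distrib_left)
    also have "\<dots> \<le> c * (\<Sum>k<N. e)"
      unfolding e_def by (intro mult_left_mono sum_mono sum_exp_neg_shift_le \<gamma> c)
    finally show ?thesis by (simp add: A_def mult_ac)
  qed
  define h where "h n = (1 / real N powr ?\<theta>) *\<^sub>R ((1 / A) *\<^sub>R g n)" for n
  have h: "h \<in> lp_ball p"
    unfolding h_def
  proof (rule lp_ballI_sum[OF p])
    show "norm ((1 / A) *\<^sub>R g n) \<le> 1" for n
      using g_le[of n] A by (cases "A = 0") (auto simp: divide_le_eq)
    show "(\<Sum>n<m. norm ((1 / A) *\<^sub>R g n)) \<le> real N" for m
    proof -
      have "(\<Sum>n<m. norm ((1 / A) *\<^sub>R g n)) = (\<Sum>n<m. norm (g n)) / A"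
        using A by (simp add: sum_divide_distrib)
      also have "\<dots> \<le> real N"
        using g_sum[of m] A by (cases "A = 0") (auto simp: divide_le_eq mult.commute)
      finally show ?thesis .
    qed
  qed (use N in simp)
  have gh: "g = (\<lambda>n. (real N powr ?\<theta> * A) *\<^sub>R h n)"
  proof
    fix n
    have "g n = A *\<^sub>R ((1 / A) *\<^sub>R g n)" using g_le[of n] by (cases "A = 0") auto
    then show "g n = (real N powr ?\<theta> * A) *\<^sub>R h n" using N by (simp add: h_def)
  qed
  have "resp g (int (\<tau> + N)) = (\<Sum>k<N. cutoff (\<tau> + k) (\<psi> k) (int (\<tau> + N)))"
    unfolding g_def resp_sum f_def resp_residual_cutoff ..
  \<comment> \<open>At time \<tau> + N every cut-off is already switched on, since k < N, and all
    restarts continue the same trajectory.\<close>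
  also have "\<dots> = (\<Sum>k<N. hom \<tau> \<phi> (int (\<tau> + N)))"
    by (intro sum.cong refl) (simp add: cutoff_def restart)
  also have "\<dots> = real N *\<^sub>R hom \<tau> \<phi> (int (\<tau> + N))" by (simp add: sum_constant_scaleR)
  finally have "real N * norm (hom \<tau> \<phi> (int (\<tau> + N))) = norm (resp g (int (\<tau> + N)))" by simp
  also have "\<dots> = real N powr ?\<theta> * A * norm (resp h (int (\<tau> + N)))"
    unfolding gh resp_scaleR using A by (simp add: abs_mult)
  also have "\<dots> \<le> real N powr ?\<theta> * A * C"
    using C(2) h A by (intro mult_left_mono) (blast, simp)
  also have "\<dots> = M * K / (1 - exp (- \<gamma>)) * C * real N powr ?\<theta> * pn \<phi>"
    by (simp add: A_def c_def e_def)
  finally show ?thesis .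
qed

text \<open>\<open>p > 1\<close> means \<theta> < 1, so the decay factor N powr (\<theta> - 1) tends
  to 0. Beyond some time all values are small, and one starting point fits windows of any
  length.\<close>

lemma small_windows_linf:
  assumes p: "1 < p" and C: "0 \<le> C" "\<forall>f\<in>lp_ball p. \<forall>n. norm (resp f (int n)) \<le> C"
    and M: "\<forall>n. \<forall>\<phi>\<in>B. norm (L n \<phi>) \<le> M * pn \<phi>" "0 \<le> M"
    and K: "1 \<le> K" "growth_B K 0" and \<delta>: "0 < \<delta>"
  shows "\<exists>N. \<forall>\<tau>. \<forall>\<phi>\<in>B. \<exists>n\<le>N. \<forall>k. n < k \<longrightarrow> k \<le> n + W \<longrightarrow>
        norm (hom \<tau> \<phi> (int (\<tau> + k))) \<le> \<delta> * pn \<phi>"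
proof -
  define \<theta> where "\<theta> = (if p = \<infinity> then 0 else 1 / real_of_ereal p)"
  have \<theta>: "\<theta> < 1" using p by (cases p) (auto simp: \<theta>_def)
  define A where "A = M * K / (1 - exp (- \<gamma>)) * C"
  have "((\<lambda>N. real N powr (\<theta> - 1)) \<longlongrightarrow> 0) sequentially"
    using \<theta> by (intro tendsto_neg_powr filterlim_real_sequentially) simp
  then have "(\<lambda>N. A * real N powr (\<theta> - 1)) \<longlonglongrightarrow> 0"
    by (rule tendsto_mult_right_zero)
  then have "\<forall>\<^sub>F N in sequentially. A * real N powr (\<theta> - 1) < \<delta>"
    using \<delta> by (rule order_tendstoD)
  then obtain N where N: "\<And>k. N \<le> k \<Longrightarrow> A * real k powr (\<theta> - 1) < \<delta>"
    by (auto simp: eventually_sequentially)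
  have "norm (hom \<tau> \<phi> (int (\<tau> + k))) \<le> \<delta> * pn \<phi>" if \<phi>: "\<phi> \<in> B" and k: "N < k" for \<tau> \<phi> k
  proof -
    have k0: "0 < real k" using k by simp
    have "real k * norm (hom \<tau> \<phi> (int (\<tau> + k))) \<le> A * real k powr \<theta> * pn \<phi>"
      unfolding A_def \<theta>_def by (rule hom_decay[OF _ C M K \<phi>]) (use p k in auto)
    also have "real k powr \<theta> = real k * real k powr (\<theta> - 1)"
      using k0 by (simp add: powr_diff)
    finally have "real k * norm (hom \<tau> \<phi> (int (\<tau> + k))) \<le> real k * (A * real k powr (\<theta> - 1) * pn \<phi>)"
      by (simp only: mult_ac)
    then have "norm (hom \<tau> \<phi> (int (\<tau> + k))) \<le> A * real k powr (\<theta> - 1) * pn \<phi>"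
      using k0 by (simp only: mult_le_cancel_left_pos)
    also have "\<dots> \<le> \<delta> * pn \<phi>" using N[of k] k by (intro mult_right_mono) auto
    finally show ?thesis .
  qed
  then show ?thesis by blast
qed

section \<open>From input-output stability to stability\<close>

lemma stable_if_lp_linf:
  assumes "1 \<le> p" "lp_lq_stable p \<infinity> L" "condition_B r \<gamma> L"
  shows "\<exists>K\<ge>1. growth_X K 0"
  using lp_linf_bound[OF assms(1,2)] L_uniform_bound[OF assms(1) _ _ assms(3)]
    growth_X_bounded[OF assms(1)] by blast

lemma exp_stable_if_lp_lq:
  assumes p: "1 \<le> p" and pq: "p \<le> q" "(p, q) \<noteq> (1, \<infinity>)"
    and stable: "lp_lq_stable p q L" and condB: "condition_B r \<gamma> L"
  shows "unif_exp_stable_B r \<gamma> L"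
proof -
  have q: "1 \<le> q" using p pq by simp
  \<comment> \<open>Nesting of the sequence spaces gives bounded responses for every
    \<open>q\<close>, so uniform stability is available before the cases on \<open>q\<close>
    separate.\<close>
  have inf: "lp_lq_stable p \<infinity> L"
    using stable lp_space_mono[OF q, of \<infinity>] unfolding lp_lq_stable_def by auto
  obtain C where C: "0 \<le> C" "\<forall>f\<in>lp_ball p. \<forall>n. norm (resp f (int n)) \<le> C"
    using lp_linf_bound[OF p inf] by blast
  obtain M where M: "\<forall>n. \<forall>\<phi>\<in>B. norm (L n \<phi>) \<le> M * pn \<phi>" "0 \<le> M"
    using L_uniform_bound[OF p C condB] by blast
  obtain K' where K': "1 \<le> K'" "growth_X K' 0"
    using growth_X_bounded[OF p C M] by blast
  then obtain K where K: "1 \<le> K" "growth_B K 0"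
    using growth_B_if_growth_X \<gamma> by blast
  show ?thesis
  proof (rule exp_stable_if_small_windows[OF K])
    fix \<delta> :: real and W assume \<delta>: "0 < \<delta>"
    show "\<exists>N. \<forall>\<tau>. \<forall>\<phi>\<in>B. \<exists>n\<le>N. \<forall>k. n < k \<longrightarrow> k \<le> n + W \<longrightarrow>
        norm (hom \<tau> \<phi> (int (\<tau> + k))) \<le> \<delta> * pn \<phi>"
    proof (cases "q = \<infinity>")
      case True
      then have "1 < p" using p pq by (auto simp: less_le)
      then show ?thesis by (rule small_windows_linf[OF _ C M K \<delta>])
    next
      case False
      obtain C' where C': "\<forall>f\<in>lp_ball p. \<forall>N. (\<Sum>n<N. norm (resp f (int n)) powr real_of_ereal q) \<le> C'"
        using lp_lq_bound[OF p q False stable] by blast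
      have "0 < real_of_ereal q" using real_of_ereal_ge_1[OF q False] by simp
      then show ?thesis by (rule small_windows_lq[OF p _ C' M K'(2) \<delta>])
    qed
  qed
qed

section \<open>Input-output stability from growth estimates\<close>

text \<open>\<open>L n \<phi>\<close> is the first new value of the solution started from
  \<open>\<phi>\<close> at time \<open>n\<close>, so growth after one step bounds every
  \<open>L n\<close>. The witness m = 0 works because \<open>tail_proj 0\<close> is the
  identity.\<close>

lemma condition_B_if_growth:
  assumes X: "growth_X K \<nu>" and K: "1 \<le> K" "0 \<le> \<nu>"
  shows "condition_B r \<gamma> L"
proof -
  have L: "norm (L n \<phi>) \<le> K * pn \<phi>" if \<phi>: "\<phi> \<in> B" for n \<phi>
  proof -
    have "L n \<phi> = hom n \<phi> (int (n + 1))"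
      using solution_step[of n n L \<phi> "\<lambda>_. 0"] by (simp add: add.commute)
    then have "norm (L n \<phi>) \<le> K * exp (- \<nu> * real 1) * pn \<phi>"
      using X \<phi> unfolding growth_X_def by (simp only:)
    also have "\<dots> \<le> K * 1 * pn \<phi>"
      using K by (intro mult_right_mono mult_left_mono) auto
    finally show ?thesis by simp
  qed
  have "phase_onorm r \<gamma> (L n \<circ> tail_proj 0) \<le> K" for n
    unfolding phase_onorm_def
  proof (rule cSUP_least)
    show "B \<noteq> {}" using zero_in_B by blast
    fix \<phi> assume "\<phi> \<in> B"
    moreover have "tail_proj 0 \<phi> = \<phi>" by (simp add: tail_proj_def)
    ultimately show "norm ((L n \<circ> tail_proj 0) \<phi>) / pn \<phi> \<le> K"
      using L[of \<phi> n] K by (cases "pn \<phi> = 0") (auto simp: divide_le_eq less_le)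
  qed
  then have "bdd_above (range (\<lambda>n. phase_onorm r \<gamma> (L n \<circ> tail_proj 0)))"
    by (rule bdd_aboveI2)
  then show ?thesis unfolding condition_B_def by blast
qed

text \<open>Telescoping over the homogeneous solutions that restart from the forced trajectory
  at time \<open>k\<close>; consecutive ones differ by a solution starting from the single impulse \<open>f k\<close>.\<close>

lemma resp_le_if_growth:
  assumes X: "growth_X K \<nu>" and K: "0 \<le> K"
  shows "norm (resp f (int n)) \<le> (\<Sum>i<n. K * exp (- \<nu> * real (n - Suc i)) * norm (f i))"
proof -
  let ?w = "\<lambda>k. hom k (prehistory (resp f) (int k))"
  have pre: "prehistory (resp f) (int k) \<in> B" for k by (rule prehistory_in_B) auto
  have step: "?w (Suc k) = (\<lambda>i. ?w k i + hom (Suc k) (single 0 (f k)) i)" for k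
  proof -
    let ?\<psi> = "prehistory (?w k) (int (Suc k))"
    have \<psi>: "?\<psi> \<in> B" by (rule prehistory_in_B[OF pre]) simp
    have eq1: "prehistory (resp f) (int (Suc k))
        = case_nat (L k (prehistory (resp f) (int k)) + f k) (prehistory (resp f) (int k))"
      using prehistory_Suc[of "resp f" "int k"] solution_step[of 0 k L "\<lambda>_. 0" f] by (simp add: add.commute)
    have eq2: "?\<psi> = case_nat (L k (prehistory (resp f) (int k))) (prehistory (resp f) (int k))"
      using prehistory_Suc[of "?w k" "int k"] solution_step[of k k L "prehistory (resp f) (int k)" "\<lambda>_. 0"]
      by (simp add: add.commute)
    have "prehistory (resp f) (int (Suc k)) = (\<lambda>j. 1 *\<^sub>R ?\<psi> j + 1 *\<^sub>R single 0 (f k) j)"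
      unfolding eq1 eq2 by (auto simp: single_def fun_eq_iff split: nat.split)
    then have "?w (Suc k) = (\<lambda>i. 1 *\<^sub>R hom (Suc k) ?\<psi> i + 1 *\<^sub>R hom (Suc k) (single 0 (f k)) i)"
      using solution_comb[OF \<psi> single_in_phase_space, of "Suc k" 1 1 0 "f k" "\<lambda>_. 0" "\<lambda>_. 0"] by simp
    moreover have "hom (Suc k) ?\<psi> = ?w k" by (rule solution_restart) simp
    ultimately show ?thesis by simp
  qed
  have "k \<le> n \<Longrightarrow> norm (?w k (int n)) \<le> (\<Sum>i<k. K * exp (- \<nu> * real (n - Suc i)) * norm (f i))" for k
  proof (induction k)
    case 0
    have "hom 0 (\<lambda>_. 0) = (\<lambda>_. 0)"
      using resp_scaleR[of 0 "\<lambda>_. 0"] by simp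
    then show ?case using prehistory_solution_init[of L 0 "\<lambda>_. 0" f] by simp
  next
    case (Suc k)
    have "norm (hom (Suc k) (single 0 (f k)) (int (Suc k + (n - Suc k))))
        \<le> K * exp (- \<nu> * real (n - Suc k)) * pn (single 0 (f k))"
      using X single_in_phase_space unfolding growth_X_def by blast
    also have "\<dots> \<le> K * exp (- \<nu> * real (n - Suc k)) * norm (f k)"
      using K by (intro mult_left_mono phase_norm_single_le r \<gamma>) auto
    also have "Suc k + (n - Suc k) = n" using Suc.prems by simp
    finally have "norm (hom (Suc k) (single 0 (f k)) (int n)) \<le> K * exp (- \<nu> * real (n - Suc k)) * norm (f k)" .
    then show ?case
      unfolding step sum.lessThan_Suc using Suc by (intro norm_triangle_le add_mono) auto
  qed
  from this[OF order_refl] have "norm (?w n (int n)) \<le> (\<Sum>i<n. K * exp (- \<nu> * real (n - Suc i)) * norm (f i))" .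
  \<comment> \<open>The last restarted solution is read at its own initial time, where it agrees
    with the response.\<close>
  moreover have "?w n (int n) = resp f (int n)"
    using fun_cong[OF prehistory_solution_init[of L n "prehistory (resp f) (int n)" "\<lambda>_. 0"], of 0]
    by (simp add: prehistory_def)
  ultimately show ?thesis by simp
qed

lemma l1_linf_stable_if_stable:
  assumes X: "growth_X K 0" and K: "1 \<le> K"
  shows "lp_lq_stable 1 \<infinity> L"
  unfolding lp_lq_stable_def
proof
  fix f :: "nat \<Rightarrow> 'a" assume "f \<in> lp_space 1"
  then have sm: "summable (\<lambda>n. norm (f n))" by (simp add: lp_space_def)
  have "norm (resp f (int n)) \<le> K * (\<Sum>n. norm (f n))" for n
  proof -
    have "norm (resp f (int n)) \<le> K * (\<Sum>i<n. norm (f i))"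
      using resp_le_if_growth[OF X, of f n] K by (simp add: sum_distrib_left)
    also have "\<dots> \<le> K * (\<Sum>n. norm (f n))"
      using K by (intro mult_left_mono sum_le_suminf sm) auto
    finally show ?thesis .
  qed
  then show "(\<lambda>n. resp f (int n)) \<in> lp_space \<infinity>"
    by (auto simp: lp_space_def bounded_iff)
qed

text \<open>The convolution bound \<open>b\<close> satisfies
  \<open>b (Suc n) = \<rho> * b n + K * norm (f n)\<close>. Read as a convex combination, this
  recursion yields a bound in lp by \<open>D\<close> times the norm of \<open>f\<close>; the nesting
  of the spaces then gives lq.\<close>

lemma lp_lq_stable_if_exp_stable:
  assumes X: "growth_X K \<nu>" and K: "1 \<le> K" and \<nu>: "0 < \<nu>" and p: "1 \<le> p" "p \<le> q"
  shows "lp_lq_stable p q L"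
  unfolding lp_lq_stable_def
proof
  fix f :: "nat \<Rightarrow> 'a" assume f: "f \<in> lp_space p"
  define \<rho> where "\<rho> = exp (- \<nu>)"
  have \<rho>: "0 < \<rho>" "\<rho> < 1" using \<nu> by (auto simp: \<rho>_def)
  define D where "D = K / (1 - \<rho>)"
  have D: "0 \<le> D" using K \<rho> by (simp add: D_def)
  define b where "b n = (\<Sum>i<n. K * exp (- \<nu> * real (n - Suc i)) * norm (f i))" for n
  have le: "norm (resp f (int n)) \<le> b n" for n
    unfolding b_def using resp_le_if_growth[OF X] K by simp
  then have b: "0 \<le> b n" for n by (rule order_trans[OF norm_ge_zero])
  have b0: "b 0 = 0" by (simp add: b_def)
  \<comment> \<open>\<open>D = K / (1 - \<rho>)\<close> makes the weights add up to 1, and the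
    coefficient is written as \<open>1 - (1 - \<rho>)\<close> to match \<open>convex_powr\<close>
    with t = 1 - \<rho>.\<close>
  have b_Suc: "b (Suc n) = (1 - (1 - \<rho>)) * b n + (1 - \<rho>) * (D * norm (f n))" for n
  proof -
    have eq: "K * exp (- \<nu> * real (Suc n - Suc i)) * norm (f i)
        = \<rho> * (K * exp (- \<nu> * real (n - Suc i)) * norm (f i))" if "i < n" for i
    proof -
      have "Suc n - Suc i = Suc (n - Suc i)" using that by simp
      then have "exp (- \<nu> * real (Suc n - Suc i)) = \<rho> * exp (- \<nu> * real (n - Suc i))"
        by (simp only:) (simp add: \<rho>_def algebra_simps flip: exp_add)
      then show ?thesis by (simp only: mult_ac)
    qed
    have "(\<Sum>i<n. K * exp (- \<nu> * real (Suc n - Suc i)) * norm (f i)) = \<rho> * b n"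
      unfolding b_def sum_distrib_left by (intro sum.cong refl eq) simp
    then have "b (Suc n) = \<rho> * b n + K * norm (f n)"
      by (simp only: b_def[of "Suc n"] sum.lessThan_Suc) simp
    then show ?thesis using \<rho> by (simp add: D_def)
  qed
  have "(\<lambda>n. resp f (int n)) \<in> lp_space p"
  proof (cases "p = \<infinity>")
    case True
    then obtain F where F: "\<And>n. norm (f n) \<le> F" using f by (auto simp: lp_space_def bounded_iff)
    have F0: "0 \<le> F" by (rule order_trans[OF norm_ge_zero F])
    have "b n \<le> D * F" for n
    proof (induction n)
      case 0
      then show ?case using D F0 by (simp add: b0)
    next
      case (Suc n)
      have "b (Suc n) \<le> (1 - (1 - \<rho>)) * (D * F) + (1 - \<rho>) * (D * F)"
        unfolding b_Suc using \<rho> D Suc F by (intro add_mono mult_left_mono) auto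
      then show ?case by (simp add: algebra_simps)
    qed
    then have "norm (resp f (int n)) \<le> D * F" for n using le order_trans by blast
    with True show ?thesis by (auto simp: lp_space_def bounded_iff)
  next
    case False
    define s where "s = real_of_ereal p"
    have s: "1 \<le> s" using real_of_ereal_ge_1[OF p(1) False] by (simp add: s_def)
    have sm: "summable (\<lambda>n. norm (f n) powr s)" using f False by (simp add: lp_space_def s_def)
    define S where "S = (\<Sum>n. norm (f n) powr s)"
    have step: "b (Suc n) powr s \<le> \<rho> * b n powr s + (1 - \<rho>) * D powr s * norm (f n) powr s" for n
    proof -
      have "b (Suc n) powr s \<le> (1 - (1 - \<rho>)) * b n powr s + (1 - \<rho>) * (D * norm (f n)) powr s"
        unfolding b_Suc using \<rho> D b s by (intro convex_powr) auto
      then show ?thesis by (simp add: powr_mult)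
    qed
    have "(\<Sum>n<N. b n powr s) \<le> D powr s * S" for N
    proof -
      \<comment> \<open>One extra term makes the shifted sum comparable: as \<open>b 0 = 0\<close>,
        the recursion returns \<rho> times the original sum, which is finite and can be absorbed on
        the left.\<close>
      have "(\<Sum>n<N. b n powr s) \<le> (\<Sum>n<Suc N. b n powr s)" by simp
      also have "\<dots> = (\<Sum>n<N. b (Suc n) powr s)"
        using s by (subst sum.lessThan_Suc_shift) (simp add: b0)
      also have "\<dots> \<le> (\<Sum>n<N. \<rho> * b n powr s + (1 - \<rho>) * D powr s * norm (f n) powr s)"
        by (intro sum_mono step)
      also have "\<dots> = \<rho> * (\<Sum>n<N. b n powr s) + (1 - \<rho>) * D powr s * (\<Sum>n<N. norm (f n) powr s)"
        by (simp only: sum.distrib sum_distrib_left)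
      also have "\<dots> \<le> \<rho> * (\<Sum>n<N. b n powr s) + (1 - \<rho>) * D powr s * S"
        unfolding S_def using \<rho> by (intro add_left_mono mult_left_mono sum_le_suminf sm) auto
      finally have "(1 - \<rho>) * (\<Sum>n<N. b n powr s) \<le> (1 - \<rho>) * (D powr s * S)"
        by (simp add: algebra_simps)
      then show ?thesis using \<rho> by simp
    qed
    then have "summable (\<lambda>n. b n powr s)" by (intro summableI_nonneg_bounded) auto
    then have "summable (\<lambda>n. norm (resp f (int n)) powr s)"
      by (rule summable_comparison_test'[where N = 0]) (use le s in \<open>auto intro: powr_mono2\<close>)
    with False show ?thesis by (simp add: lp_space_def s_def)
  qed
  then show "(\<lambda>n. resp f (int n)) \<in> lp_space q" by (rule lp_space_mono[OF p])
qed

end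

theorem theorem7p2:
  fixes r \<gamma> :: real
    and L :: "nat \<Rightarrow> (nat \<Rightarrow> 'a::banach) \<Rightarrow> 'a"
  assumes "1 \<le> r"
    and "\<gamma> > 0"
    and "\<And>n. bounded_linear_on_phase r \<gamma> (L n)"
  shows "(\<forall>p q :: ereal. 1 \<le> p \<longrightarrow> p \<le> q \<longrightarrow> (p, q) \<noteq> (1, \<infinity>) \<longrightarrow>
            (unif_exp_stable_X r \<gamma> L \<longleftrightarrow> unif_exp_stable_B r \<gamma> L) \<and>
            (unif_exp_stable_B r \<gamma> L \<longleftrightarrow> lp_lq_stable p q L \<and> condition_B r \<gamma> L)) \<and>
         (unif_stable_B r \<gamma> L \<longleftrightarrow> unif_stable_X r \<gamma> L) \<and>
         (unif_stable_B r \<gamma> L \<longleftrightarrow> lp_lq_stable 1 \<infinity> L \<and> condition_B r \<gamma> L)"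
proof -
  interpret delay_system r \<gamma> L by unfold_locales (use assms in auto)
  have XB: "unif_exp_stable_X r \<gamma> L \<longleftrightarrow> unif_exp_stable_B r \<gamma> L"
    using exp_stable_X_imp_B exp_stable_B_imp_X by blast
  have exp: "unif_exp_stable_B r \<gamma> L \<longleftrightarrow> lp_lq_stable p q L \<and> condition_B r \<gamma> L"
    if pq: "1 \<le> p" "p \<le> q" "(p, q) \<noteq> (1, \<infinity>)" for p q :: ereal
  proof
    assume "unif_exp_stable_B r \<gamma> L"
    then obtain K \<nu> where "1 \<le> K" "0 < \<nu>" "growth_X K \<nu>"
      unfolding XB[symmetric] unif_exp_stable_X_iff by blast
    then show "lp_lq_stable p q L \<and> condition_B r \<gamma> L"
      using lp_lq_stable_if_exp_stable pq(1,2) condition_B_if_growth less_imp_le by blast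
  qed (use exp_stable_if_lp_lq[OF pq] in blast)
  have "unif_stable_X r \<gamma> L \<longleftrightarrow> lp_lq_stable 1 \<infinity> L \<and> condition_B r \<gamma> L"
    unfolding unif_stable_X_iff
    using stable_if_lp_linf[of 1] l1_linf_stable_if_stable condition_B_if_growth[of _ 0] by auto
  with XB exp stable_X_iff_B show ?thesis by blast
qed

end
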